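(* Let $\alpha>0$ and let $X=\{X(t),t\ge 0\}$, with laws $(\mathbb{P}_x)_{x>0}$, be an increasing positive self-similar Markov process with self-similarity index $1/\alpha$, and let $\xi$ be the subordinator associated to $X$ via Lamperti's transformation, with Laplace exponent $\phi$. Assume that $\phi$ is not regularly varying at $0$ with a strictly positive index, and let $h:(0,\infty)\to(0,\infty)$ be a function. If $h(t)/\log(t)$ tends to $0$ or to $\infty$ as $t\to\infty$, and the law of $\log\big(X(t)/t^{1/\alpha}\big)/h(t)$ under $\mathbb{P}_1$ converges weakly, as $t\to\infty$, to the law of a real-valued random variable, then the limiting random variable is degenerate (i.e. a.s. constant).
   Context: An increasing positive self-similar Markov process with index $1/\alpha$ is a $(0,\infty)$-valued strong Markov process $X$ with càdlàg nondecreasing paths such that, $\mathbb{P}_x$ denoting its law started from $x>0$, for every $c>0$ and $x>0$ the process $\{cX(tc^{-\alpha}),t\ge0\}$ under $\mathbb{P}_x$ has the same law as $\{X(t),t\ge 0\}$ under $\mathbb{P}_{cx}$. A subordinator is a càdlàg real-valued process with stationary independent increments and nondecreasing paths (no killing), started at $0$. Its Laplace exponent is $\phi(\lambda)=-\log \mathbf{E}(e^{-\lambda\xi_1})=d\lambda+\int_{(0,\infty)}(1-e^{-\lambda x})\Pi(dx)$, $\lambda\ge 0$, where $d\ge 0$ and $\int (1\wedge x)\Pi(dx)<\infty$. Lamperti's transformation: the subordinator associated to $X$ is $\xi_t=\log\big(X(\gamma_t)/X(0)\big)$, where $\gamma$ is the inverse of $t\mapsto\int_0^tX(s)^{-\alpha}ds$.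 Conversely, given a subordinator $\xi$ with law $\mathbf{P}$, $\mathbb{P}_x$ is the law of $\{x\exp(\xi_{\tau(tx^{-\alpha})}),t\ge0\}$, where $\tau$ is the inverse of $t\mapsto C_t=\int_0^t e^{\alpha\xi_s}ds$. $\phi$ is regularly varying at $0$ with index $\beta$ if $\lim_{\lambda\to0+}\phi(c\lambda)/\phi(\lambda)=c^\beta$ for every $c>0$. *)

theory Defs
  imports "HOL-Probability.Probability"
begin

text \<open>
  Processes are functions \<open>real \<Rightarrow> 'a \<Rightarrow> real\<close>, of which only the values at times \<open>t \<ge> 0\<close> matter.
\<close>

definition cadlag :: "(real \<Rightarrow> real) \<Rightarrow> bool" where
  "cadlag f \<longleftrightarrow>
     (\<forall>t\<ge>0. continuous (at_right t) f) \<and> (\<forall>t>0. \<exists>l. (f \<longlongrightarrow> l) (at_left t))"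

definition path :: "(real \<Rightarrow> 'a \<Rightarrow> real) \<Rightarrow> 'a \<Rightarrow> real \<Rightarrow> real" where
  "path X \<omega> = (\<lambda>t\<in>{0..}. X t \<omega>)"

abbreviation path_space :: "(real \<Rightarrow> real) measure" where
  "path_space \<equiv> \<Pi>\<^sub>M t\<in>{0..}. borel"

definition path_law :: "'a measure \<Rightarrow> (real \<Rightarrow> 'a \<Rightarrow> real) \<Rightarrow> (real \<Rightarrow> real) measure" where
  "path_law M X = distr M path_space (path X)"

text \<open>
  Time is extended to \<open>[0, \<infinity>]\<close>, so that stopping times may be infinite; at \<open>\<infinity>\<close> the filtration
  is the \<open>\<sigma>\<close>-algebra generated by the whole process.
\<close>

definition natural_filtration :: "'a set \<Rightarrow> (real \<Rightarrow> 'a \<Rightarrow> real) \<Rightarrow> ennreal \<Rightarrow> 'a measure" where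
  "natural_filtration \<Omega> X t =
     sigma \<Omega> {X s -` B \<inter> \<Omega> | s B. 0 \<le> s \<and> ennreal s \<le> t \<and> B \<in> sets borel}"

text \<open>
  In \<open>strong_markov\<close>, \<open>filtration.pre_sigma \<Omega> F T\<close> is the \<open>\<sigma>\<close>-algebra of events up to the stopping
  time \<open>T\<close>: conditionally on it and on \<open>T < \<infinity>\<close>, the process after time \<open>T\<close> has the law of the
  process started from its value at time \<open>T\<close>.
\<close>

locale increasing_pssmp =
  fixes \<alpha> :: real and P :: "real \<Rightarrow> 'a measure" and X :: "real \<Rightarrow> 'a \<Rightarrow> real" and \<Omega> :: "'a set"
  defines "\<Omega> \<equiv> space (P 1)"
  assumes prob_space_P: "\<And>x. x > 0 \<Longrightarrow> prob_space (P x)"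
    and sets_P: "\<And>x. x > 0 \<Longrightarrow> sets (P x) = sets (P 1)"
    and measurable_X: "\<And>t. t \<ge> 0 \<Longrightarrow> X t \<in> borel_measurable (P 1)"
    and positive: "\<And>t \<omega>. t \<ge> 0 \<Longrightarrow> \<omega> \<in> \<Omega> \<Longrightarrow> X t \<omega> > 0"
    and cadlag_paths: "\<And>\<omega>. \<omega> \<in> \<Omega> \<Longrightarrow> cadlag (\<lambda>t. X t \<omega>)"
    and nondecreasing_paths: "\<And>\<omega>. \<omega> \<in> \<Omega> \<Longrightarrow> mono_on {0..} (\<lambda>t. X t \<omega>)"
    and start: "\<And>x. x > 0 \<Longrightarrow> AE \<omega> in P x. X 0 \<omega> = x"
    and kernel: "(\<lambda>x. path_law (P x) X) \<in> restrict_space borel {0<..} \<rightarrow>\<^sub>M prob_algebra path_space"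
    and strong_markov: "\<And>x T A B.
      x > 0 \<Longrightarrow> stopping_time (natural_filtration \<Omega> X) T \<Longrightarrow>
      A \<in> sets (filtration.pre_sigma \<Omega> (natural_filtration \<Omega> X) T) \<Longrightarrow> B \<in> sets path_space \<Longrightarrow>
      emeasure (P x) {\<omega> \<in> A. T \<omega> < \<infinity> \<and> path (\<lambda>t. X (enn2real (T \<omega>) + t)) \<omega> \<in> B} =
      (\<integral>\<^sup>+\<omega>\<in>{\<omega> \<in> A. T \<omega> < \<infinity>}. emeasure (path_law (P (X (enn2real (T \<omega>)) \<omega>)) X) B \<partial>P x)"
    and self_similar: "\<And>c x. c > 0 \<Longrightarrow> x > 0 \<Longrightarrow>
      path_law (P x) (\<lambda>t \<omega>. c * X (t * c powr (- \<alpha>)) \<omega>) = path_law (P (c * x)) X"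

definition subordinator :: "'a measure \<Rightarrow> (real \<Rightarrow> 'a \<Rightarrow> real) \<Rightarrow> bool" where
  "subordinator M \<xi> \<longleftrightarrow>
     prob_space M \<and>
     (\<forall>t\<ge>0. \<xi> t \<in> borel_measurable M) \<and>
     (AE \<omega> in M. \<xi> 0 \<omega> = 0) \<and>
     (AE \<omega> in M. cadlag (\<lambda>t. \<xi> t \<omega>)) \<and>
     (AE \<omega> in M. mono_on {0..} (\<lambda>t. \<xi> t \<omega>)) \<and>
     (\<forall>s\<ge>0. \<forall>t\<ge>0. distr M borel (\<lambda>\<omega>. \<xi> (s + t) \<omega> - \<xi> s \<omega>) = distr M borel (\<lambda>\<omega>. \<xi> t \<omega> - \<xi> 0 \<omega>)) \<and>
     (\<forall>(t :: nat \<Rightarrow> real) n. 0 \<le> t 0 \<longrightarrow> incseq t \<longrightarrow>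
        prob_space.indep_vars M (\<lambda>_. borel) (\<lambda>i \<omega>. \<xi> (t (Suc i)) \<omega> - \<xi> (t i) \<omega>) {..<n})"

definition laplace_exponent :: "'a measure \<Rightarrow> (real \<Rightarrow> 'a \<Rightarrow> real) \<Rightarrow> real \<Rightarrow> real" where
  "laplace_exponent M \<xi> l = - ln (\<integral>\<omega>. exp (- l * \<xi> 1 \<omega>) \<partial>M)"

definition lamperti_clock :: "real \<Rightarrow> (real \<Rightarrow> 'a \<Rightarrow> real) \<Rightarrow> 'a \<Rightarrow> real \<Rightarrow> real" where
  "lamperti_clock \<alpha> X \<omega> t = (LINT s:{0..t}|lborel. X s \<omega> powr (- \<alpha>))"

text \<open>
  The clock of a positive nondecreasing path is continuous and strictly increasing, so the infimum
  below is its inverse at every \<open>t \<ge> 0\<close> in its range. The range is almost surely all of \<open>[0, \<infinity>)\<close>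
  for an increasing positive self-similar Markov process; the value 0 outside it only keeps the
  transform measurable.
\<close>

definition lamperti_time :: "real \<Rightarrow> (real \<Rightarrow> 'a \<Rightarrow> real) \<Rightarrow> 'a \<Rightarrow> real \<Rightarrow> real" where
  "lamperti_time \<alpha> X \<omega> t =
     (if \<exists>s\<ge>0. lamperti_clock \<alpha> X \<omega> s > t then Inf {s. s \<ge> 0 \<and> lamperti_clock \<alpha> X \<omega> s > t} else 0)"

definition lamperti :: "real \<Rightarrow> (real \<Rightarrow> 'a \<Rightarrow> real) \<Rightarrow> real \<Rightarrow> 'a \<Rightarrow> real" where
  "lamperti \<alpha> X t \<omega> = ln (X (lamperti_time \<alpha> X \<omega> t) \<omega> / X 0 \<omega>)"

definition regularly_varying_at_0 :: "(real \<Rightarrow> real) \<Rightarrow> real \<Rightarrow> bool" where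
  "regularly_varying_at_0 \<phi> \<beta> \<longleftrightarrow>
     (\<forall>c>0. ((\<lambda>l. \<phi> (c * l) / \<phi> l) \<longlongrightarrow> c powr \<beta>) (at_right 0))"

text \<open>The analogue of \<^const>\<open>weak_conv_m\<close> for a family indexed by a real parameter tending to infinity.\<close>

definition weak_conv_at_top :: "(real \<Rightarrow> real measure) \<Rightarrow> real measure \<Rightarrow> bool" where
  "weak_conv_at_top M N \<longleftrightarrow>
     (\<forall>x. isCont (cdf N) x \<longrightarrow> ((\<lambda>t. cdf (M t) x) \<longlongrightarrow> cdf N x) at_top)"

end

theory Submission
  imports Defs
begin

text \<open>
  Write \<open>L = log X\<close>. If \<open>h(t) / log t \<rightarrow> \<infinity>\<close>, then \<open>L(t) / h(t)\<close> has the same limit \<open>Y \<ge> 0\<close>.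
  Compare the times \<open>t\<close> and \<open>T\<close>, where \<open>2 log T = \<alpha> y h(t)\<close>. If \<open>L(t) > y h(t)\<close>, then by self-similarity
  \<open>X\<close> hardly moves between \<open>t\<close> and \<open>T\<close>, so \<open>L(T)\<close> is of order \<open>h(t)\<close>, which is negligible against \<open>h(T)\<close>;
  otherwise \<open>X\<close> restarts at time \<open>t\<close> from a level that is negligible on the scale \<open>h(T)\<close>. Hence
  \<open>p \<le> (1 - p) p\<close> for \<open>p = Pr(Y > 0)\<close>, that is, \<open>Y = 0\<close>.

  If \<open>h(t) / log t \<rightarrow> 0\<close>, then \<open>L(t) / log t \<rightarrow> 1 / \<alpha>\<close> in probability. Consequently the walk \<open>\<xi>(n \<eta>)\<close>, for
  small \<open>\<eta>\<close>, is unlikely to jump across \<open>[(1 - \<epsilon>) y, y]\<close> for large \<open>y\<close>. With \<open>a(l) = E exp(- l \<xi>(\<eta>))\<close>,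
  a renewal identity expresses \<open>(1 - a(l)) / (1 - a(l + q))\<close> as an integral over \<open>y\<close> involving the last
  value of the walk below \<open>y\<close>, which is now known to be close to \<open>y\<close>. This gives \<open>\<phi>(c l) / \<phi>(l) \<rightarrow> c\<close>: regular
  variation with index \<open>1\<close>, which is excluded.
\<close>

section \<open>Tails and weak convergence\<close>

lemma (in prob_space) prob_greater_eq_cdf:
  fixes Z :: "'a \<Rightarrow> real"
  assumes "Z \<in> borel_measurable M"
  shows "measure M {\<omega> \<in> space M. Z \<omega> > x} = 1 - cdf (distr M borel Z) x"
proof -
  have "cdf (distr M borel Z) x = measure M {\<omega> \<in> space M. Z \<omega> \<le> x}"
    unfolding cdf_def
    by (subst measure_distr) (use assms in \<open>auto simp: vimage_def Int_def conj_commute\<close>)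
  moreover have "{\<omega> \<in> space M. Z \<omega> > x} = space M - {\<omega> \<in> space M. Z \<omega> \<le> x}"
    by auto
  ultimately show ?thesis
    using assms by (simp add: prob_compl)
qed

text \<open>The limit cdf is monotone, so it has only countably many discontinuities and some
  continuity point lies strictly between \<open>u\<close> and \<open>v\<close>. Both tails are
  compared at that point; the gap allows \<open>u\<close> and \<open>v\<close> themselves to be
  atoms.\<close>

lemma weak_conv_at_top_tails:
  assumes "prob_space M" "prob_space N" "Y \<in> borel_measurable N"
    and Z: "eventually (\<lambda>t. Z t \<in> borel_measurable M) at_top"
    and conv: "weak_conv_at_top (\<lambda>t. distr M borel (Z t)) (distr N borel Y)"
    and "u < v" "e > 0"
  shows weak_conv_at_top_tail_le:
      "eventually (\<lambda>t. measure M {\<omega> \<in> space M. Z t \<omega> > v} \<le> measure N {\<omega> \<in> space N. Y \<omega> > u} + e) at_top"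
    and weak_conv_at_top_tail_ge:
      "eventually (\<lambda>t. measure M {\<omega> \<in> space M. Z t \<omega> > u} \<ge> measure N {\<omega> \<in> space N. Y \<omega> > v} - e) at_top"
proof -
  interpret M: prob_space M by fact
  interpret N: prob_space N by fact
  interpret D: real_distribution "distr N borel Y"
    by (rule N.real_distribution_distr) fact
  have "mono (cdf (distr N borel Y))"
    by (simp add: mono_def D.cdf_nondecreasing)
  then obtain x where x: "u < x" "x < v" "isCont (cdf (distr N borel Y)) x"
    using open_minus_countable[OF mono_ctble_discont, of "cdf (distr N borel Y)" "{u<..<v}"] \<open>u < v\<close> by auto
  have lim: "((\<lambda>t. cdf (distr M borel (Z t)) x) \<longlongrightarrow> cdf (distr N borel Y) x) at_top"
    using conv x by (simp add: weak_conv_at_top_def)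
  have "eventually (\<lambda>t. \<bar>cdf (distr M borel (Z t)) x - cdf (distr N borel Y) x\<bar> < e) at_top"
    using tendstoD[OF lim \<open>e > 0\<close>] by (simp add: dist_real_def)
  then have near: "eventually (\<lambda>t. Z t \<in> borel_measurable M \<and>
      \<bar>measure M {\<omega> \<in> space M. Z t \<omega> > x} - measure N {\<omega> \<in> space N. Y \<omega> > x}\<bar> < e) at_top"
    using Z
  proof eventually_elim
    case (elim t)
    then show ?case
      using M.prob_greater_eq_cdf[of "Z t" x] N.prob_greater_eq_cdf[OF assms(3), of x] by simp
  qed
  have Y: "measure N {\<omega> \<in> space N. Y \<omega> > x} \<le> measure N {\<omega> \<in> space N. Y \<omega> > u}"
      "measure N {\<omega> \<in> space N. Y \<omega> > v} \<le> measure N {\<omega> \<in> space N. Y \<omega> > x}"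
    by (intro N.finite_measure_mono; use x assms(3) in auto)+
  show "eventually (\<lambda>t. measure M {\<omega> \<in> space M. Z t \<omega> > v} \<le> measure N {\<omega> \<in> space N. Y \<omega> > u} + e) at_top"
    using near
  proof eventually_elim
    case (elim t)
    then have "measure M {\<omega> \<in> space M. Z t \<omega> > v} \<le> measure M {\<omega> \<in> space M. Z t \<omega> > x}"
      by (intro M.finite_measure_mono) (use x in auto)
    with elim Y show ?case by linarith
  qed
  show "eventually (\<lambda>t. measure M {\<omega> \<in> space M. Z t \<omega> > u} \<ge> measure N {\<omega> \<in> space N. Y \<omega> > v} - e) at_top"
    using near
  proof eventually_elim
    case (elim t)
    then have "measure M {\<omega> \<in> space M. Z t \<omega> > x} \<le> measure M {\<omega> \<in> space M. Z t \<omega> > u}"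
      by (intro M.finite_measure_mono) (use x in auto)
    with elim Y show ?case by linarith
  qed
qed

lemma (in prob_space) prob_greater_at_top:
  fixes Y :: "'a \<Rightarrow> real"
  assumes [measurable]: "Y \<in> borel_measurable M" and "e > 0"
  obtains m where "m > 0" "measure M {\<omega> \<in> space M. Y \<omega> > m} < e"
    "measure M {\<omega> \<in> space M. Y \<omega> > - m} > 1 - e"
proof -
  interpret D: real_distribution "distr M borel Y"
    by (rule real_distribution_distr) (rule assms)
  have "eventually (\<lambda>x. cdf (distr M borel Y) x > 1 - e) at_top"
    by (rule order_tendstoD(1)[OF D.cdf_lim_at_top_prob]) (use \<open>e > 0\<close> in simp)
  moreover have "eventually (\<lambda>x. cdf (distr M borel Y) (- x) < e) at_top"
    using order_tendstoD(2)[OF D.cdf_lim_at_bot \<open>e > 0\<close>] by (simp add: at_bot_mirror eventually_filtermap)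
  ultimately have "eventually (\<lambda>x. x > 0 \<and> cdf (distr M borel Y) x > 1 - e \<and> cdf (distr M borel Y) (- x) < e) at_top"
    using eventually_gt_at_top[of 0] by eventually_elim auto
  then obtain m where "m > 0 \<and> cdf (distr M borel Y) m > 1 - e \<and> cdf (distr M borel Y) (- m) < e"
    by (auto dest!: eventually_happens)
  then show ?thesis
    by (intro that[of m]) (auto simp: prob_greater_eq_cdf)
qed

section \<open>Increasing positive self-similar Markov processes\<close>

lemma filtration_natural_filtration: "filtration \<Omega> (natural_filtration \<Omega> X)"
proof
  show "space (natural_filtration \<Omega> X t) = \<Omega>" for t
    unfolding natural_filtration_def by (rule space_measure_of) auto
  show "sets (natural_filtration \<Omega> X s) \<subseteq> sets (natural_filtration \<Omega> X t)" if "s \<le> t" for s t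
    unfolding natural_filtration_def
    by (subst (1 2) sets_measure_of; (rule sigma_sets_subseteq)?)
       (use that in \<open>auto intro: order_trans\<close>)
qed

context increasing_pssmp
begin

sublocale P1: prob_space "P 1"
  by (rule prob_space_P) simp

lemma level_sets:
  "t \<ge> 0 \<Longrightarrow> A \<in> sets borel \<Longrightarrow> {\<omega> \<in> \<Omega>. X t \<omega> \<in> A} \<in> sets (P 1)"
  using measurable_sets[OF measurable_X, of t A] by (simp add: \<Omega>_def vimage_def Int_def conj_commute)

lemma measurable_path:
  assumes "\<And>t. t \<ge> 0 \<Longrightarrow> Y t \<in> borel_measurable M"
  shows "path Y \<in> M \<rightarrow>\<^sub>M path_space"
  unfolding path_def by (rule measurable_restrict) (use assms in auto)

lemma emeasure_path_law:
  assumes "\<And>t. t \<ge> 0 \<Longrightarrow> Y t \<in> borel_measurable M" "B \<in> sets path_space"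
  shows "emeasure (path_law M Y) B = emeasure M {\<omega> \<in> space M. path Y \<omega> \<in> B}"
  unfolding path_law_def using assms
  by (subst emeasure_distr[OF measurable_path]) (auto simp: vimage_def Int_def conj_commute)

lemma mono_X: "\<omega> \<in> \<Omega> \<Longrightarrow> 0 \<le> s \<Longrightarrow> s \<le> t \<Longrightarrow> X s \<omega> \<le> X t \<omega>"
  using nondecreasing_paths[of \<omega>] by (auto simp: mono_on_def)

section \<open>Tail probabilities under self-similarity and the Markov property\<close>

definition tail :: "real \<Rightarrow> real \<Rightarrow> real" where
  "tail r c = measure (P 1) {\<omega> \<in> \<Omega>. X r \<omega> > c}"

lemma tail_sets: "t \<ge> 0 \<Longrightarrow> {\<omega> \<in> \<Omega>. X t \<omega> > c} \<in> sets (P 1)"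
  using level_sets[of t "{c<..}"] by simp

lemma tail_mono: "0 \<le> r \<Longrightarrow> r \<le> r' \<Longrightarrow> tail r c \<le> tail r' c"
  unfolding tail_def
  by (rule P1.finite_measure_mono) (auto intro: tail_sets less_le_trans[OF _ mono_X])

lemma sets_growth: "s \<ge> 0 \<Longrightarrow> {w \<in> space path_space. w s > c * w 0} \<in> sets path_space"
  by (intro borel_measurable_less borel_measurable_times borel_measurable_const measurable_component_singleton) auto

lemma AE_start: "AE \<omega> in P 1. X 0 \<omega> = 1"
  by (rule start) simp

text \<open>Self-similarity turns \<open>P x\<close> into \<open>P 1\<close> with space scaled by
  \<open>x\<close> and time by \<open>x powr - \<alpha>\<close>. Growth is measured relative to the
  initial value so that the space factor cancels.\<close>

lemma growth_from:
  assumes "x > 0" "s \<ge> 0"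
  shows "emeasure (path_law (P x) X) {w \<in> space path_space. w s > c * w 0} = ennreal (tail (s * x powr - \<alpha>) c)"
proof -
  note [measurable] = measurable_X
  let ?B = "{w \<in> space path_space. w s > c * w 0}"
  have "emeasure (path_law (P x) X) ?B =
      emeasure (path_law (P 1) (\<lambda>t \<omega>. x * X (t * x powr - \<alpha>) \<omega>)) ?B"
    using self_similar[of x 1] assms by simp
  also have "\<dots> = emeasure (P 1) {\<omega> \<in> \<Omega>. path (\<lambda>t \<omega>. x * X (t * x powr - \<alpha>) \<omega>) \<omega> \<in> ?B}"
    by (subst emeasure_path_law) (use assms sets_growth in \<open>auto simp: \<Omega>_def\<close>)
  also have "\<dots> = emeasure (P 1) {\<omega> \<in> \<Omega>. X (s * x powr - \<alpha>) \<omega> > c * X 0 \<omega>}"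
    by (intro arg_cong[where f = "emeasure (P 1)"])
       (use assms in \<open>auto simp: path_def space_PiM PiE_def\<close>)
  also have "\<dots> = emeasure (P 1) {\<omega> \<in> \<Omega>. X (s * x powr - \<alpha>) \<omega> > c}"
    by (rule emeasure_eq_AE) (use AE_start assms in \<open>auto simp: \<Omega>_def\<close>)
  also have "\<dots> = ennreal (tail (s * x powr - \<alpha>) c)"
    unfolding tail_def by (simp add: P1.emeasure_eq_measure)
  finally show ?thesis .
qed

text \<open>The Markov property at the constant time \<open>t\<close> restarts the process from
  \<open>X t\<close>. By \<open>growth_from\<close> a higher starting level shortens the rescaled
  time, so replacing \<open>X t\<close> by its lower bound \<open>a\<close> can only increase the
  probability.\<close>

lemma growth_after_le:
  assumes "\<alpha> > 0" "t \<ge> 0" "s \<ge> 0" "a > 0" "A \<in> sets borel" "A \<subseteq> {a..}"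
  shows "measure (P 1) {\<omega> \<in> \<Omega>. X t \<omega> \<in> A \<and> X (t + s) \<omega> > c * X t \<omega>}
    \<le> measure (P 1) {\<omega> \<in> \<Omega>. X t \<omega> \<in> A} * tail (s * a powr - \<alpha>) c"
proof -
  interpret F: filtration \<Omega> "natural_filtration \<Omega> X"
    by (rule filtration_natural_filtration)
  let ?T = "\<lambda>_. ennreal t" and ?A = "{\<omega> \<in> \<Omega>. X t \<omega> \<in> A}"
  let ?B = "{w \<in> space path_space. w s > c * w 0}"
  have "{\<omega> \<in> ?A. ?T \<omega> \<le> u} \<in> sets (natural_filtration \<Omega> X u)" for u
  proof (cases "ennreal t \<le> u")
    case True
    then have "X t -` A \<inter> \<Omega> \<in> sets (natural_filtration \<Omega> X u)"
      unfolding natural_filtration_def using assms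
      by (subst sets_measure_of) (auto intro!: sigma_sets.Basic)
    then show ?thesis using True by (simp add: vimage_def Int_def conj_commute)
  qed simp
  then have A: "?A \<in> sets (F.pre_sigma ?T)"
    by (intro F.sets_pre_sigmaI stopping_time_const)
  have "emeasure (P 1) {\<omega> \<in> \<Omega>. X t \<omega> \<in> A \<and> X (t + s) \<omega> > c * X t \<omega>} =
      emeasure (P 1) {\<omega> \<in> ?A. ?T \<omega> < \<infinity> \<and> path (\<lambda>u. X (enn2real (?T \<omega>) + u)) \<omega> \<in> ?B}"
    by (intro arg_cong[where f = "emeasure (P 1)"])
       (use assms in \<open>auto simp: path_def space_PiM PiE_def\<close>)
  also have "\<dots> = (\<integral>\<^sup>+\<omega>\<in>{\<omega> \<in> ?A. ?T \<omega> < \<infinity>}. emeasure (path_law (P (X (enn2real (?T \<omega>)) \<omega>)) X) ?B \<partial>P 1)"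
    by (rule strong_markov) (use A sets_growth assms stopping_time_const in auto)
  also have "\<dots> \<le> (\<integral>\<^sup>+\<omega>. ennreal (tail (s * a powr - \<alpha>) c) * indicator ?A \<omega> \<partial>P 1)"
  proof (rule nn_integral_mono)
    fix \<omega>
    have "tail (s * X t \<omega> powr - \<alpha>) c \<le> tail (s * a powr - \<alpha>) c" if "\<omega> \<in> \<Omega>" "X t \<omega> \<in> A"
      using assms that by (intro tail_mono mult_left_mono powr_mono2') auto
    then show "emeasure (path_law (P (X (enn2real (?T \<omega>)) \<omega>)) X) ?B * indicator {\<omega> \<in> ?A. ?T \<omega> < \<infinity>} \<omega>
        \<le> ennreal (tail (s * a powr - \<alpha>) c) * indicator ?A \<omega>"
      using assms positive by (auto simp: indicator_def growth_from intro!: ennreal_leI)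
  qed
  also have "\<dots> = ennreal (tail (s * a powr - \<alpha>) c) * emeasure (P 1) ?A"
    by (rule nn_integral_cmult_indicator) (use assms level_sets in auto)
  finally show ?thesis
    by (simp add: P1.emeasure_eq_measure mult.commute tail_def flip: ennreal_mult)
qed

text \<open>Right-continuity at time \<open>0\<close>, where \<open>X 0 = 1 < c\<close>, makes the
  decreasing events \<open>X (1 / (n + 1)) > c\<close> shrink to a null set. This later renders a
  fast doubling of \<open>X\<close> negligible when the time step is small.\<close>

lemma tail_at_0:
  assumes "c > 1" "e > 0"
  shows "\<exists>r>0. tail r c < e"
proof -
  let ?A = "\<lambda>n. {\<omega> \<in> \<Omega>. X (1 / real (Suc n)) \<omega> > c}"
  have "(\<lambda>n. measure (P 1) (?A n)) \<longlonglongrightarrow> measure (P 1) (\<Inter>n. ?A n)"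
  proof (rule P1.finite_Lim_measure_decseq)
    show "range ?A \<subseteq> sets (P 1)" by (auto intro: tail_sets)
    show "decseq ?A"
      unfolding decseq_def
    proof safe
      fix m n :: nat and \<omega> assume "m \<le> n" "\<omega> \<in> \<Omega>" "c < X (1 / real (Suc n)) \<omega>"
      moreover from this have "X (1 / real (Suc n)) \<omega> \<le> X (1 / real (Suc m)) \<omega>"
        by (intro mono_X) (auto simp: frac_le)
      ultimately show "c < X (1 / real (Suc m)) \<omega>" by simp
    qed
  qed
  also have "measure (P 1) (\<Inter>n. ?A n) = measure (P 1) {}"
  proof (rule measure_eq_AE)
    show "AE \<omega> in P 1. \<omega> \<in> (\<Inter>n. ?A n) \<longleftrightarrow> \<omega> \<in> {}"
      using AE_start
    proof eventually_elim
      fix \<omega> assume 0: "X 0 \<omega> = 1"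
      have False if "\<omega> \<in> (\<Inter>n. ?A n)"
      proof -
        have "\<omega> \<in> \<Omega>" using that by auto
        then have "((\<lambda>t. X t \<omega>) \<longlongrightarrow> X 0 \<omega>) (at_right 0)"
          using cadlag_paths[of \<omega>] by (simp add: cadlag_def continuous_within)
        moreover have "filterlim (\<lambda>n. 1 / real (Suc n)) (at_right 0) sequentially"
          using LIMSEQ_Suc[OF lim_1_over_n] by (intro tendsto_imp_filterlim_at_right) simp_all
        ultimately have "(\<lambda>n. X (1 / real (Suc n)) \<omega>) \<longlonglongrightarrow> X 0 \<omega>"
          by (rule filterlim_compose)
        then have "c \<le> X 0 \<omega>"
        proof (rule LIMSEQ_le_const, intro exI allI impI)
          show "c \<le> X (1 / real (Suc n)) \<omega>" for n
            using that by (simp add: less_imp_le)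
        qed
        then show False using 0 assms by simp
      qed
      then show "\<omega> \<in> (\<Inter>n. ?A n) \<longleftrightarrow> \<omega> \<in> {}" by auto
    qed
  next
    show "(\<Inter>n. ?A n) \<in> sets (P 1)"
      by (rule sets.countable_INT) (auto intro: tail_sets)
  qed auto
  finally have "eventually (\<lambda>n. tail (1 / real (Suc n)) c < e) sequentially"
    using assms order_tendstoD(2)[of _ 0 sequentially e] by (simp add: tail_def)
  then obtain n where "tail (1 / real (Suc n)) c < e"
    by (auto simp: eventually_sequentially)
  then show ?thesis by (intro exI[of _ "1 / real (Suc n)"]) auto
qed

lemma space_P1 [simp]: "space (P 1) = \<Omega>"
  by (simp add: \<Omega>_def)

lemma exp_less_X_iff: "t \<ge> 0 \<Longrightarrow> \<omega> \<in> \<Omega> \<Longrightarrow> exp y < X t \<omega> \<longleftrightarrow> y < ln (X t \<omega>)"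
  using positive[of t \<omega>] by (metis exp_less_cancel_iff exp_ln)

lemma tail_exp: "t \<ge> 0 \<Longrightarrow> tail t (exp y) = measure (P 1) {\<omega> \<in> \<Omega>. ln (X t \<omega>) > y}"
  unfolding tail_def by (intro arg_cong[where f = "measure (P 1)"]) (auto simp: exp_less_X_iff)

lemma ln_normalized:
  "t > 0 \<Longrightarrow> \<omega> \<in> \<Omega> \<Longrightarrow> ln (X t \<omega> / t powr (1 / \<alpha>)) = ln (X t \<omega>) - ln t / \<alpha>"
  using positive[of t \<omega>] by (simp add: ln_div ln_powr)

lemma measurable_normalized:
  "t > 0 \<Longrightarrow> (\<lambda>\<omega>. ln (X t \<omega> / t powr (1 / \<alpha>)) / d) \<in> borel_measurable (P 1)"
  using measurable_X[of t] by measurable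

lemma tail_antimono: "t \<ge> 0 \<Longrightarrow> c \<le> c' \<Longrightarrow> tail t c' \<le> tail t c"
  unfolding tail_def by (rule P1.finite_measure_mono) (auto intro: tail_sets)

lemma AE_ge_1: "AE \<omega> in P 1. \<forall>t\<ge>0. X t \<omega> \<ge> 1"
proof -
  have "AE \<omega> in P 1. \<omega> \<in> \<Omega>"
    using AE_space[of "P 1"] by simp
  with AE_start show ?thesis
    by eventually_elim (use mono_X in force)
qed

text \<open>The dyadic levels of \<open>X t\<close> are disjoint events. On level \<open>k\<close>
  the process starts from at least \<open>2 ^ k\<close>, which exactly compensates the waiting time
  \<open>r * (2 ^ k) powr \<alpha>\<close>; the conditional bound \<open>tail r 2\<close> is
  therefore the same on every level and factors out of the sum.\<close>

lemma doubling_prob_le: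
  assumes "\<alpha> > 0" "t \<ge> 0" "r \<ge> 0"
  shows "measure (P 1) (\<Union>k. {\<omega> \<in> \<Omega>. X t \<omega> \<in> {2 ^ k..<2 ^ Suc k} \<and> X (t + r * (2 ^ k) powr \<alpha>) \<omega> > 2 * X t \<omega>})
    \<le> tail r 2"
proof -
  let ?A = "\<lambda>k. {\<omega> \<in> \<Omega>. X t \<omega> \<in> {2 ^ k..<2 ^ Suc k}}"
  let ?E = "\<lambda>k. {\<omega> \<in> \<Omega>. X t \<omega> \<in> {2 ^ k..<2 ^ Suc k} \<and> X (t + r * (2 ^ k) powr \<alpha>) \<omega> > 2 * X t \<omega>}"
  have A: "?A k \<in> sets (P 1)" for k
    by (rule level_sets) (use assms in auto)
  have E: "?E k \<in> sets (P 1)" for k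
  proof -
    have [measurable]: "X t \<in> borel_measurable (P 1)" "X (t + r * (2 ^ k) powr \<alpha>) \<in> borel_measurable (P 1)"
      using assms by (auto intro!: measurable_X)
    show ?thesis by (simp flip: space_P1)
  qed
  have disj: "disjoint_family (\<lambda>k. {2 ^ k..<2 ^ Suc k :: real})"
    unfolding disjoint_family_on_def
  proof (intro ballI impI)
    have "{2 ^ j..<2 ^ Suc j :: real} \<inter> {2 ^ k..<2 ^ Suc k} = {}" if "j < k" for j k :: nat
    proof -
      have "(2 :: real) ^ Suc j \<le> 2 ^ k" using that by (intro power_increasing) auto
      then show ?thesis by auto
    qed
    then show "{2 ^ m..<2 ^ Suc m :: real} \<inter> {2 ^ n..<2 ^ Suc n} = {}" if "m \<noteq> n" for m n :: nat
      using that by (metis Int_commute nat_neq_iff)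
  qed
  have sums_A: "(\<lambda>k. measure (P 1) (?A k) * tail r 2) sums (measure (P 1) (\<Union>k. ?A k) * tail r 2)"
    by (intro sums_mult2 P1.finite_measure_UNION)
       (use A disj in \<open>fastforce simp: disjoint_family_on_def\<close>)+
  have sums_E: "(\<lambda>k. measure (P 1) (?E k)) sums measure (P 1) (\<Union>k. ?E k)"
    by (intro P1.finite_measure_UNION)
       (use E disj in \<open>fastforce simp: disjoint_family_on_def\<close>)+
  have E_le: "measure (P 1) (?E k) \<le> measure (P 1) (?A k) * tail r 2" for k
    using growth_after_le[of t "r * (2 ^ k) powr \<alpha>" "2 ^ k" "{2 ^ k..<2 ^ Suc k}" 2] assms
    by (auto simp: subset_iff mult.assoc simp flip: powr_add)
  have "measure (P 1) (\<Union>k. ?E k) \<le> measure (P 1) (\<Union>k. ?A k) * tail r 2"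
    by (rule sums_le[OF E_le sums_E sums_A])
  also have "\<dots> \<le> 1 * tail r 2"
    by (intro mult_right_mono) (auto simp: tail_def)
  finally show ?thesis by simp
qed

section \<open>The Lamperti clock, its inverse, and long jumps\<close>

lemma clock_integrable:
  assumes "\<omega> \<in> \<Omega>" "\<alpha> > 0" "0 \<le> a" "A \<in> sets borel" "A \<subseteq> {a..b}"
  shows "set_integrable lborel A (\<lambda>s. X s \<omega> powr - \<alpha>)"
proof -
  \<comment> \<open>The values of \<open>X\<close> at negative times are arbitrary. Clamping the
    argument gives a function that is monotone on the whole line, hence Borel, and agrees with the
    integrand on \<open>A\<close>.\<close>
  let ?g = "\<lambda>s. X (max 0 s) \<omega> powr - \<alpha>"
  have "mono (\<lambda>s. - ?g s)"
    unfolding mono_def using assms positive mono_X by (auto intro!: powr_mono2')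
  then have "(\<lambda>s. - (- ?g s)) \<in> borel_measurable borel"
    by (intro borel_measurable_uminus borel_measurable_mono)
  then have g: "?g \<in> borel_measurable lborel" by simp
  have "emeasure lborel A \<le> emeasure lborel {a..b}"
    using assms by (intro emeasure_mono) auto
  then have "emeasure lborel A < \<infinity>"
    by (rule order.strict_trans1) (simp add: emeasure_lborel_Icc_eq)
  moreover have "AE s in lborel. s \<in> A \<longrightarrow> norm (?g s) \<le> X 0 \<omega> powr - \<alpha>"
    using assms positive mono_X by (auto intro!: powr_mono2')
  ultimately have "set_integrable lborel A ?g"
    unfolding set_integrable_def using assms g by (intro integrableI_bounded_set_indicator) auto
  also have "set_integrable lborel A ?g \<longleftrightarrow> set_integrable lborel A (\<lambda>s. X s \<omega> powr - \<alpha>)"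
    by (intro set_integrable_cong) (use assms in \<open>auto simp: max_def\<close>)
  finally show ?thesis .
qed

text \<open>Along a nondecreasing path the integrand is nonincreasing, so on \<open>{s<..t}\<close>
  it is bounded below by its value at the right endpoint.\<close>

lemma clock_increment_ge:
  assumes "\<omega> \<in> \<Omega>" "\<alpha> > 0" "0 \<le> s" "s \<le> t"
  shows "lamperti_clock \<alpha> X \<omega> t - lamperti_clock \<alpha> X \<omega> s \<ge> (t - s) * X t \<omega> powr - \<alpha>"
proof -
  have "{0..t} = {0..s} \<union> {s<..t}" using assms by auto
  then have "lamperti_clock \<alpha> X \<omega> t = lamperti_clock \<alpha> X \<omega> s + (LINT u:{s<..t}|lborel. X u \<omega> powr - \<alpha>)"
    unfolding lamperti_clock_def using assms
    by (simp only:, subst set_integral_Un) (auto intro: clock_integrable[of _ 0 _ t])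
  moreover have "(LINT u:{s<..t}|lborel. X t \<omega> powr - \<alpha>) \<le> (LINT u:{s<..t}|lborel. X u \<omega> powr - \<alpha>)"
    by (intro set_integral_mono clock_integrable[of _ s _ t])
       (use assms positive mono_X in \<open>auto intro!: powr_mono2' simp: set_integrable_def\<close>)
  moreover have "(LINT u:{s<..t}|lborel. X t \<omega> powr - \<alpha>) = (t - s) * X t \<omega> powr - \<alpha>"
    using assms by (simp add: set_lebesgue_integral_def)
  ultimately show ?thesis by simp
qed

lemma clock_strict_mono:
  assumes "\<omega> \<in> \<Omega>" "\<alpha> > 0" "0 \<le> s" "s < t"
  shows "lamperti_clock \<alpha> X \<omega> s < lamperti_clock \<alpha> X \<omega> t"
proof -
  have "0 < (t - s) * X t \<omega> powr - \<alpha>"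
    using assms positive[of t \<omega>] by simp
  also have "\<dots> \<le> lamperti_clock \<alpha> X \<omega> t - lamperti_clock \<alpha> X \<omega> s"
    by (rule clock_increment_ge) (use assms in auto)
  finally show ?thesis by simp
qed

lemma clock_mono:
  assumes "\<omega> \<in> \<Omega>" "\<alpha> > 0" "0 \<le> s" "s \<le> t"
  shows "lamperti_clock \<alpha> X \<omega> s \<le> lamperti_clock \<alpha> X \<omega> t"
  using clock_strict_mono[of \<omega> s t] assms by (cases "s = t") auto

lemma lamperti_time_nonneg: "lamperti_time \<alpha> X \<omega> u \<ge> 0"
  unfolding lamperti_time_def by (auto intro!: cInf_greatest)

lemma lamperti_time_le:
  assumes "s \<ge> 0" "lamperti_clock \<alpha> X \<omega> s > u"
  shows "lamperti_time \<alpha> X \<omega> u \<le> s"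
  unfolding lamperti_time_def using assms by (auto intro!: cInf_lower bdd_belowI[of _ 0])

text \<open>Since the clock exceeds \<open>u\<close> somewhere, \<open>lamperti_time\<close> is a
  true infimum and not the default \<open>0\<close>. Hence a time before \<open>t\<close> already
  has clock value above \<open>u\<close>, and the clock is monotone.\<close>

lemma less_clock_if_lamperti_time_less:
  assumes "\<omega> \<in> \<Omega>" "\<alpha> > 0" "s \<ge> 0" "lamperti_clock \<alpha> X \<omega> s > u" "lamperti_time \<alpha> X \<omega> u < t"
  shows "u < lamperti_clock \<alpha> X \<omega> t"
proof -
  have "Inf {s. s \<ge> 0 \<and> lamperti_clock \<alpha> X \<omega> s > u} < t"
    using assms by (auto simp: lamperti_time_def split: if_splits)
  then obtain s' where "s' \<ge> 0" "lamperti_clock \<alpha> X \<omega> s' > u" "s' < t"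
    using assms cInf_lessD[of "{s. s \<ge> 0 \<and> lamperti_clock \<alpha> X \<omega> s > u}" t] by auto
  then show ?thesis
    using clock_mono[of \<omega> s' t] assms by simp
qed

lemma lamperti_less_imp_clock:
  assumes "\<omega> \<in> \<Omega>" "\<alpha> > 0" "s \<ge> 0" "lamperti_clock \<alpha> X \<omega> s > u"
    and "t \<ge> 0" "lamperti \<alpha> X u \<omega> < ln (X t \<omega> / X 0 \<omega>)"
  shows "u < lamperti_clock \<alpha> X \<omega> t"
proof (rule less_clock_if_lamperti_time_less[OF assms(1-4)], rule ccontr)
  assume "\<not> lamperti_time \<alpha> X \<omega> u < t"
  then have "X t \<omega> \<le> X (lamperti_time \<alpha> X \<omega> u) \<omega>"
    using assms by (intro mono_X) auto
  then have "ln (X t \<omega> / X 0 \<omega>) \<le> lamperti \<alpha> X u \<omega>"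
    unfolding lamperti_def using positive assms lamperti_time_nonneg
    by (intro ln_mono divide_right_mono) (auto intro: less_imp_le)
  with assms show False by simp
qed

lemma less_lamperti_imp_clock:
  assumes "\<omega> \<in> \<Omega>" "\<alpha> > 0" "t \<ge> 0" "lamperti \<alpha> X u \<omega> > ln (X t \<omega> / X 0 \<omega>)"
  shows "lamperti_clock \<alpha> X \<omega> t \<le> u" "\<exists>s\<ge>0. lamperti_clock \<alpha> X \<omega> s > u"
proof -
  have *: "lamperti \<alpha> X u \<omega> \<le> ln (X t \<omega> / X 0 \<omega>)" if "lamperti_time \<alpha> X \<omega> u \<le> t"
    unfolding lamperti_def using positive assms lamperti_time_nonneg mono_X that
    by (intro ln_mono divide_right_mono) (auto intro: less_imp_le)
  show "lamperti_clock \<alpha> X \<omega> t \<le> u"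
    using * lamperti_time_le[of t u \<omega>] assms by linarith
  \<comment> \<open>If \<open>u\<close> lay outside the range of the clock, the default time
    \<open>0 \<le> t\<close> would make \<open>lamperti\<close> too small for the
    hypothesis.\<close>
  show "\<exists>s\<ge>0. lamperti_clock \<alpha> X \<omega> s > u"
  proof (rule ccontr)
    assume "\<not> (\<exists>s\<ge>0. lamperti_clock \<alpha> X \<omega> s > u)"
    then have "lamperti_time \<alpha> X \<omega> u = 0"
      unfolding lamperti_time_def by (rule if_not_P)
    with * assms show False by simp
  qed
qed

text \<open>
  The clock advances by less than \<open>\<eta>\<close> on \<open>[t, T]\<close>, which is impossible unless \<open>X\<close> doubles
  within a time comparable to \<open>\<eta> (X t)\<^sup>\<alpha>\<close> after \<open>t\<close>. The dyadic levels make that time deterministic.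
\<close>

lemma long_jump_imp_doubling:
  assumes "\<omega> \<in> \<Omega>" "\<alpha> > 0" "0 \<le> t" "X 0 \<omega> = 1" "\<eta> > 0"
    and "lamperti \<alpha> X u \<omega> < x" "y < lamperti \<alpha> X (u + \<eta>) \<omega>"
    and "exp x < X t \<omega>" "X t \<omega> \<le> exp z" "X T \<omega> \<le> exp y" "2 * \<eta> * 4 powr \<alpha> * exp (\<alpha> * z) \<le> T - t"
  shows "\<exists>k. X t \<omega> \<in> {2 ^ k..<2 ^ Suc k} \<and> X (t + 2 * \<eta> * 4 powr \<alpha> * (2 ^ k) powr \<alpha>) \<omega> > 2 * X t \<omega>"
proof -
  let ?C = "lamperti_clock \<alpha> X \<omega>"
  have "0 < 2 * \<eta> * 4 powr \<alpha> * exp (\<alpha> * z)" using assms by simp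
  then have "t < T" using assms by linarith
  have pos: "X t \<omega> > 0" "X T \<omega> > 0" "X t \<omega> \<ge> 1"
    using positive assms mono_X[of \<omega> 0 t] \<open>t < T\<close> by auto
  have "ln (X T \<omega> / X 0 \<omega>) < lamperti \<alpha> X (u + \<eta>) \<omega>"
    using assms pos exp_less_X_iff[of T \<omega> y] \<open>t < T\<close> by simp
  \<comment> \<open>The witness \<open>s\<close> shows that \<open>u + \<eta>\<close>, and therefore
    also \<open>u\<close>, lies in the range of the clock.\<close>
  from less_lamperti_imp_clock[OF assms(1,2) _ this] assms \<open>t < T\<close>
  obtain s where s: "?C T \<le> u + \<eta>" "s \<ge> 0" "?C s > u + \<eta>" by auto
  have "lamperti \<alpha> X u \<omega> < ln (X t \<omega> / X 0 \<omega>)"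
    using assms exp_less_X_iff[of t \<omega> x] by simp
  then have "u < ?C t"
    using lamperti_less_imp_clock[of \<omega> s u t] assms s by simp
  with s have C: "?C T - ?C t < \<eta>" by simp
  define k where "k = nat \<lfloor>log 2 (X t \<omega>)\<rfloor>"
  have k: "X t \<omega> \<in> {2 ^ k..<2 ^ Suc k}"
  proof -
    have "real k \<le> log 2 (X t \<omega>)" "log 2 (X t \<omega>) < real (Suc k)"
      using pos unfolding k_def by (simp_all add: le_floor_iff) linarith
    then have "2 powr real k \<le> X t \<omega>" "X t \<omega> < 2 powr real (Suc k)"
      using pos by (simp_all only: le_log_iff log_less_iff) 
    then show ?thesis by (simp only: powr_realpow) auto
  qed
  \<comment> \<open>The waiting time depends on the path only through \<open>k\<close>. If
    \<open>X\<close> at most doubled during it, then \<open>X (t + r)\<close> would be at most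
    \<open>4 * 2 ^ k\<close> and the clock would gain at least \<open>2 * \<eta>\<close>, whereas
    less than \<open>\<eta>\<close> is available up to \<open>T\<close>.\<close>
  define r where "r = 2 * \<eta> * 4 powr \<alpha> * (2 ^ k) powr \<alpha>"
  have "r > 0" using assms by (simp add: r_def)
  have "(2 ^ k) powr \<alpha> \<le> exp z powr \<alpha>"
    using k assms by (intro powr_mono2) auto
  then have "r \<le> 2 * \<eta> * 4 powr \<alpha> * exp (\<alpha> * z)"
    unfolding r_def using assms by (simp add: exp_powr_real mult.commute)
  then have "t + r \<le> T" using assms by simp
  have "\<not> X (t + r) \<omega> \<le> 2 * X t \<omega>"
  proof
    assume "X (t + r) \<omega> \<le> 2 * X t \<omega>"
    then have "X (t + r) \<omega> \<le> 4 * 2 ^ k" using k by simp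
    then have "(4 * 2 ^ k) powr - \<alpha> \<le> X (t + r) \<omega> powr - \<alpha>"
      using assms \<open>r > 0\<close> positive[of "t + r" \<omega>] by (intro powr_mono2') auto
    then have "r * (4 * 2 ^ k) powr - \<alpha> \<le> r * X (t + r) \<omega> powr - \<alpha>"
      using \<open>r > 0\<close> by simp
    also have "\<dots> \<le> ?C (t + r) - ?C t"
      using clock_increment_ge[of \<omega> t "t + r"] assms \<open>r > 0\<close> by simp
    also have "\<dots> \<le> ?C T - ?C t"
      using clock_mono[of \<omega> "t + r" T] assms \<open>r > 0\<close> \<open>t + r \<le> T\<close> by simp
    also have "\<dots> < \<eta>" by fact
    also have "r * (4 * 2 ^ k) powr - \<alpha> = 2 * \<eta>"
      by (simp add: r_def powr_mult powr_minus field_simps)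
    finally show False using assms by simp
  qed
  then show ?thesis using k unfolding r_def by (intro exI[of _ k]) auto
qed

text \<open>An argument \<open>u\<close> strictly between the clock values at \<open>t\<close> and
  \<open>t + 1\<close> lies in the range of the clock, and its inverse time is at least
  \<open>t\<close>. The lemma serves to show that a vanishing subordinator forces constant paths of
  \<open>X\<close>.\<close>

lemma lamperti_pos_if_X_increases:
  assumes "\<omega> \<in> \<Omega>" "\<alpha> > 0" "t \<ge> 0" "X t \<omega> > X 0 \<omega>"
  shows "\<exists>u>0. lamperti \<alpha> X u \<omega> > 0"
proof -
  let ?C = "lamperti_clock \<alpha> X \<omega>"
  have "?C 0 \<le> ?C t" "?C t < ?C (t + 1)"
    using clock_mono[of \<omega> 0 t] clock_strict_mono[of \<omega> t "t + 1"] assms by auto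
  moreover have "?C 0 \<ge> 0"
    unfolding lamperti_clock_def set_lebesgue_integral_def by (rule Bochner_Integration.integral_nonneg) simp
  ultimately obtain u where u: "?C t < u" "u < ?C (t + 1)" "u > 0"
    using dense[of "?C t" "?C (t + 1)"] by fastforce
  have "\<not> lamperti_time \<alpha> X \<omega> u < t"
    using less_clock_if_lamperti_time_less[of \<omega> "t + 1" u t] u assms by auto
  then have "X t \<omega> \<le> X (lamperti_time \<alpha> X \<omega> u) \<omega>"
    using assms by (intro mono_X) auto
  then have "lamperti \<alpha> X u \<omega> > 0"
    unfolding lamperti_def using assms positive[of 0 \<omega>] by (intro ln_gt_zero) simp
  with u show ?thesis by blast
qed


text \<open>This is convergence of \<open>ln (X t) / ln t\<close> to \<open>1 / \<alpha>\<close> in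
  probability under \<open>P 1\<close>, phrased through \<open>tail\<close> so that monotonicity in
  the level applies directly.\<close>

definition growth_exponent :: bool where
  "growth_exponent \<longleftrightarrow> (\<forall>\<delta>>0. \<forall>e>0.
     eventually (\<lambda>t. tail t (exp ((1 / \<alpha> + \<delta>) * ln t)) \<le> e) at_top \<and>
     eventually (\<lambda>t. tail t (exp ((1 / \<alpha> - \<delta>) * ln t)) \<ge> 1 - e) at_top)"

text \<open>The path is observed at two times \<open>t y < T y\<close>. By the growth exponent, with
  high probability \<open>ln (X (t y))\<close> lies between \<open>(1 - \<epsilon>) * y\<close> and
  \<open>(1 - \<epsilon> / 2) * y\<close>, and \<open>ln (X (T y))\<close> does not exceed
  \<open>y\<close>. A long jump across this window then forces a fast doubling after
  \<open>t y\<close>. Each of the three exceptional events costs \<open>e / 3\<close>.\<close>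

lemma eventually_long_jump_prob_le:
  fixes \<eta> :: real
  assumes "growth_exponent" "\<alpha> > 0" "\<eta> > 0" "0 < \<epsilon>" "\<epsilon> < 1" "e > 0"
    and meas: "\<And>u. u \<ge> 0 \<Longrightarrow> lamperti \<alpha> X u \<in> borel_measurable (P 1)"
  shows "eventually (\<lambda>y. measure (P 1) {\<omega> \<in> \<Omega>. \<exists>n::nat. lamperti \<alpha> X (real n * \<eta>) \<omega> < (1 - \<epsilon>) * y \<and>
      y < lamperti \<alpha> X (real (Suc n) * \<eta>) \<omega>} \<le> tail (2 * \<eta> * 4 powr \<alpha>) 2 + e) at_top"
proof -
  define r where "r = 2 * \<eta> * 4 powr \<alpha>"
  have "r > 0" using assms by (simp add: r_def)
  \<comment> \<open>After multiplication by \<open>\<alpha>\<close> the relative error of the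
    exponents is \<open>\<epsilon> / 8\<close>, small enough for the three comparisons in
    \<open>exps\<close>.\<close>
  define \<delta> where "\<delta> = \<epsilon> / (8 * \<alpha>)"
  have "\<delta> > 0" using assms by (simp add: \<delta>_def)
  define t where "t y = exp (\<alpha> * (1 - 3 * \<epsilon> / 4) * y)" for y
  define T where "T y = exp (\<alpha> * (1 - \<epsilon> / 4) * y)" for y
  have lim: "filterlim (\<lambda>y. exp (c * y)) at_top at_top" if "c > 0" for c :: real
    by (rule filterlim_compose[OF exp_at_top])
       (use filterlim_tendsto_pos_mult_at_top[OF tendsto_const that filterlim_ident] in simp)
  have tT: "filterlim t at_top at_top" "filterlim T at_top at_top"
    unfolding t_def T_def using assms by (auto intro!: lim mult_pos_pos)
  have ln_tT: "ln (t y) = \<alpha> * (1 - 3 * \<epsilon> / 4) * y" "ln (T y) = \<alpha> * (1 - \<epsilon> / 4) * y" for y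
    by (simp_all add: t_def T_def)
  have "e / 3 > 0" using assms by simp
  note growth = assms(1)[unfolded growth_exponent_def, rule_format, OF \<open>\<delta> > 0\<close> this]
  note up = growth[THEN conjunct1] and low = growth[THEN conjunct2]
  have \<epsilon>4: "\<alpha> * \<epsilon> / 4 > 0" using assms by simp
  show ?thesis
    using eventually_compose_filterlim[OF up tT(1)] eventually_compose_filterlim[OF low tT(1)]
      eventually_compose_filterlim[OF up tT(2)]
      filterlim_at_top[THEN iffD1, OF lim[OF \<epsilon>4], rule_format, of "r + 1"] eventually_gt_at_top[of 0]
  proof eventually_elim
    case (elim y)
    let ?B = "{\<omega> \<in> \<Omega>. \<exists>n::nat. lamperti \<alpha> X (real n * \<eta>) \<omega> < (1 - \<epsilon>) * y \<and> y < lamperti \<alpha> X (real (Suc n) * \<eta>) \<omega>}"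
    let ?L = "{\<omega> \<in> \<Omega>. X (t y) \<omega> > exp ((1 - \<epsilon>) * y)}"
    let ?U = "{\<omega> \<in> \<Omega>. X (t y) \<omega> > exp ((1 - \<epsilon> / 2) * y)}"
    let ?V = "{\<omega> \<in> \<Omega>. X (T y) \<omega> > exp y}"
    let ?E = "\<Union>k. {\<omega> \<in> \<Omega>. X (t y) \<omega> \<in> {2 ^ k..<2 ^ Suc k} \<and> X (t y + r * (2 ^ k) powr \<alpha>) \<omega> > 2 * X (t y) \<omega>}"
    have nonneg: "t y \<ge> 0" "T y \<ge> 0" by (simp_all add: t_def T_def)
    have exps: "exp ((1 / \<alpha> - \<delta>) * ln (t y)) \<ge> exp ((1 - \<epsilon>) * y)"
        "exp ((1 / \<alpha> + \<delta>) * ln (t y)) \<le> exp ((1 - \<epsilon> / 2) * y)"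
        "exp ((1 / \<alpha> + \<delta>) * ln (T y)) \<le> exp y"
    proof -
      have *: "(1 / \<alpha> - \<delta>) * ln (t y) = (1 - \<epsilon> / 8) * (1 - 3 * \<epsilon> / 4) * y"
        "(1 / \<alpha> + \<delta>) * ln (t y) = (1 + \<epsilon> / 8) * (1 - 3 * \<epsilon> / 4) * y"
        "(1 / \<alpha> + \<delta>) * ln (T y) = (1 + \<epsilon> / 8) * (1 - \<epsilon> / 4) * y"
        using assms(2) by (simp_all add: ln_tT \<delta>_def field_simps)
      have "\<epsilon> * \<epsilon> \<ge> 0" "\<epsilon> * \<epsilon> \<le> 1 * \<epsilon>" using assms by (auto intro!: mult_right_mono)
      then have "1 - \<epsilon> \<le> (1 - \<epsilon> / 8) * (1 - 3 * \<epsilon> / 4)" "(1 + \<epsilon> / 8) * (1 - 3 * \<epsilon> / 4) \<le> 1 - \<epsilon> / 2"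
        "(1 + \<epsilon> / 8) * (1 - \<epsilon> / 4) \<le> 1"
        using assms by (simp_all add: algebra_simps)
      from this[THEN mult_right_mono, of y] show
        "exp ((1 / \<alpha> - \<delta>) * ln (t y)) \<ge> exp ((1 - \<epsilon>) * y)"
        "exp ((1 / \<alpha> + \<delta>) * ln (t y)) \<le> exp ((1 - \<epsilon> / 2) * y)"
        "exp ((1 / \<alpha> + \<delta>) * ln (T y)) \<le> exp y"
        using elim(5) unfolding * exp_le_cancel_iff by simp_all
    qed
    \<comment> \<open>\<open>T y\<close> exceeds the time scale on the left by the factor
      \<open>exp (\<alpha> * \<epsilon> / 4 * y)\<close>, which is eventually at least
      \<open>r + 1\<close>; the extra \<open>1\<close> pays for subtracting
      \<open>t y\<close>.\<close>
    have gap: "r * exp (\<alpha> * ((1 - \<epsilon> / 2) * y)) \<le> T y - t y"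
    proof -
      let ?z = "exp (\<alpha> * ((1 - \<epsilon> / 2) * y))"
      have "T y = exp (\<alpha> * \<epsilon> / 4 * y) * ?z"
        unfolding T_def exp_add[symmetric] by (simp add: algebra_simps)
      also have "\<dots> \<ge> (r + 1) * ?z"
        by (intro mult_right_mono) (use elim in auto)
      moreover have "t y \<le> ?z"
        unfolding t_def using assms elim by (simp add: mult_left_mono mult_right_mono mult.assoc)
      ultimately show ?thesis by (simp add: algebra_simps)
    qed
    have E: "{\<omega> \<in> \<Omega>. X (t y) \<omega> \<in> {2 ^ k..<2 ^ Suc k} \<and> X (t y + r * (2 ^ k) powr \<alpha>) \<omega> > 2 * X (t y) \<omega>} \<in> sets (P 1)"
      for k :: nat
    proof -
      have [measurable]: "X (t y) \<in> borel_measurable (P 1)" "X (t y + r * (2 ^ k) powr \<alpha>) \<in> borel_measurable (P 1)"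
        using nonneg \<open>r > 0\<close> by (auto intro!: measurable_X)
      show ?thesis by (simp flip: space_P1)
    qed
    have sets: "space (P 1) - ?L \<in> sets (P 1)" "?U \<in> sets (P 1)" "?V \<in> sets (P 1)" "?E \<in> sets (P 1)"
      by (intro sets.Diff sets.top tail_sets nonneg sets.countable_UN; use E in blast)+
    have "measure (P 1) ?B \<le> measure (P 1) ((space (P 1) - ?L) \<union> ?U \<union> ?V \<union> ?E)"
    proof (rule P1.finite_measure_mono_AE)
      show "AE \<omega> in P 1. \<omega> \<in> ?B \<longrightarrow> \<omega> \<in> (space (P 1) - ?L) \<union> ?U \<union> ?V \<union> ?E"
        using AE_start
      proof (eventually_elim, intro impI)
        fix \<omega> assume \<omega>: "X 0 \<omega> = 1" "\<omega> \<in> ?B"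
        then obtain n :: nat where n: "\<omega> \<in> \<Omega>" "lamperti \<alpha> X (real n * \<eta>) \<omega> < (1 - \<epsilon>) * y"
            "y < lamperti \<alpha> X (real n * \<eta> + \<eta>) \<omega>"
          by (auto simp: algebra_simps)
        show "\<omega> \<in> (space (P 1) - ?L) \<union> ?U \<union> ?V \<union> ?E"
        proof (rule ccontr)
          assume neg: "\<not> ?thesis"
          with n have "exp ((1 - \<epsilon>) * y) < X (t y) \<omega>" "X (t y) \<omega> \<le> exp ((1 - \<epsilon> / 2) * y)" "X (T y) \<omega> \<le> exp y"
            by auto
          then have "\<exists>k. X (t y) \<omega> \<in> {2 ^ k..<2 ^ Suc k} \<and> X (t y + r * (2 ^ k) powr \<alpha>) \<omega> > 2 * X (t y) \<omega>"
            using long_jump_imp_doubling[of \<omega> "t y" \<eta> "real n * \<eta>" "(1 - \<epsilon>) * y" y "(1 - \<epsilon> / 2) * y" "T y"]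
              n \<omega>(1) assms(2,3) nonneg(1) gap by (simp only: r_def)
          with n(1) have "\<omega> \<in> ?E" by blast
          with neg show False by blast
        qed
      qed
    qed (intro sets.Un sets)
    also have "\<dots> \<le> measure (P 1) (space (P 1) - ?L) + measure (P 1) ?U + measure (P 1) ?V + measure (P 1) ?E"
      by (intro order_trans[OF measure_Un_le] add_mono order_refl sets.Un sets)
    also have "measure (P 1) (space (P 1) - ?L) = 1 - tail (t y) (exp ((1 - \<epsilon>) * y))"
      unfolding tail_def by (intro P1.prob_compl tail_sets nonneg)
    also have "\<dots> \<le> e / 3"
      using tail_antimono[OF nonneg(1) exps(1)] elim(2) by simp
    also have "measure (P 1) ?U \<le> e / 3"
      using tail_antimono[OF nonneg(1) exps(2)] elim(1) by (simp add: tail_def)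
    also have "measure (P 1) ?V \<le> e / 3"
      using tail_antimono[OF nonneg(2) exps(3)] elim(3) by (simp add: tail_def)
    also have "measure (P 1) ?E \<le> tail r 2"
      by (rule doubling_prob_le) (use assms nonneg \<open>r > 0\<close> in auto)
    finally show ?case by (simp add: r_def)
  qed
qed

text \<open>Constant paths would make the tail vanish at the level
  \<open>t powr (1 / (2 * \<alpha>)) \<ge> 1\<close>, where the growth exponent requires at least
  \<open>1 / 2\<close>. This excludes a vanishing Laplace exponent later on.\<close>

lemma growth_exponent_not_const:
  assumes "growth_exponent" "\<alpha> > 0"
  shows "\<not> (AE \<omega> in P 1. \<forall>t\<ge>0. X t \<omega> \<le> X 0 \<omega>)"
proof
  assume const: "AE \<omega> in P 1. \<forall>t\<ge>0. X t \<omega> \<le> X 0 \<omega>"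
  have "eventually (\<lambda>t. tail t (exp ((1 / \<alpha> - 1 / (2 * \<alpha>)) * ln t)) \<ge> 1 - 1 / 2) at_top"
    using assms(1)[unfolded growth_exponent_def, rule_format, of "1 / (2 * \<alpha>)" "1 / 2"] assms(2) by simp
  with eventually_ge_at_top[of 1] have "eventually (\<lambda>t :: real. False) at_top"
  proof eventually_elim
    case (elim t)
    have "1 / \<alpha> - 1 / (2 * \<alpha>) \<ge> 0" using assms by (simp add: field_simps)
    then have "exp ((1 / \<alpha> - 1 / (2 * \<alpha>)) * ln t) \<ge> 1" using elim by simp
    then have "tail t (exp ((1 / \<alpha> - 1 / (2 * \<alpha>)) * ln t)) \<le> tail t 1"
      using elim by (intro tail_antimono) auto
    also have "tail t 1 = measure (P 1) {}"
      unfolding tail_def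
    proof (rule P1.finite_measure_eq_AE)
      show "AE \<omega> in P 1. \<omega> \<in> {\<omega> \<in> \<Omega>. 1 < X t \<omega>} \<longleftrightarrow> \<omega> \<in> {}"
        using const AE_start
      proof eventually_elim
        fix \<omega> assume "\<forall>t\<ge>0. X t \<omega> \<le> X 0 \<omega>" "X 0 \<omega> = 1"
        moreover have "t \<ge> 0" using elim by simp
        ultimately show "\<omega> \<in> {\<omega> \<in> \<Omega>. 1 < X t \<omega>} \<longleftrightarrow> \<omega> \<in> {}" by fastforce
      qed
    qed (intro tail_sets sets.empty_sets; use elim in simp)+
    finally show ?case using elim by simp
  qed
  then show False by simp
qed

end

section \<open>Laplace exponents of subordinators\<close>

lemma nn_integral_exp_atLeast:
  fixes c l :: real
  assumes "c > 0" "l \<ge> 0"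
  shows "(\<integral>\<^sup>+y. ennreal (l * exp (- c * y)) * indicator {0..} y \<partial>lborel) = ennreal (l / c)"
proof -
  have "((\<lambda>y. - (l / c) * exp (- (c * y))) \<longlongrightarrow> - (l / c) * 0) at_top"
    by (intro tendsto_mult tendsto_const filterlim_compose[OF exp_at_bot]
          filterlim_compose[OF filterlim_uminus_at_bot_at_top]
          filterlim_tendsto_pos_mult_at_top[OF tendsto_const \<open>c > 0\<close>] filterlim_ident)
  then have "((\<lambda>y. - (l / c) * exp (- c * y)) \<longlongrightarrow> 0) at_top" by simp
  then have "(\<integral>\<^sup>+y. ennreal (l * exp (- c * y)) * indicator {0..} y \<partial>lborel) =
      ennreal (0 - (- (l / c) * exp (- c * 0)))"
    by (intro nn_integral_FTC_atLeast) (use assms in \<open>auto intro!: derivative_eq_intros\<close>)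
  then show ?thesis by simp
qed

lemma nn_integral_exp_Ico:
  fixes l s t :: real
  assumes "l > 0" "s \<le> t"
  shows "(\<integral>\<^sup>+y. (if s \<le> y \<and> y < t then ennreal (l * exp (- l * y)) else 0) \<partial>lborel) =
    ennreal (exp (- l * s) - exp (- l * t))"
proof -
  have "(\<integral>\<^sup>+y. (if s \<le> y \<and> y < t then ennreal (l * exp (- l * y)) else 0) \<partial>lborel) =
      (\<integral>\<^sup>+y. ennreal (l * exp (- l * y)) * indicator {s..t} y \<partial>lborel)"
    by (rule nn_integral_cong_AE, use AE_lborel_singleton[of t] in eventually_elim) (auto simp: indicator_def)
  also have "\<dots> = ennreal (- exp (- l * t) - (- exp (- l * s)))"
    by (rule nn_integral_FTC_Icc) (use assms in \<open>auto intro!: derivative_eq_intros\<close>)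
  finally show ?thesis by simp
qed

text \<open>Convexity of \<open>exp\<close> between \<open>0\<close> and \<open>x\<close>. Both
  concavity estimates for the Laplace exponent rest on it.\<close>

lemma exp_chord_le:
  fixes \<theta> x :: real
  assumes "0 \<le> \<theta>" "\<theta> \<le> 1"
  shows "exp (\<theta> * x) \<le> \<theta> * exp x + (1 - \<theta>)"
  using convex_onD[OF exp_convex, of \<theta> 0 x] assms by simp

section \<open>Laplace transforms of a sampled subordinator and a renewal bound\<close>

locale subordinator_process = prob_space M for M :: "'a measure" +
  fixes \<xi> :: "real \<Rightarrow> 'a \<Rightarrow> real"
  assumes subordinator: "subordinator M \<xi>"
begin

lemma measurable_sub [measurable]: "t \<ge> 0 \<Longrightarrow> \<xi> t \<in> borel_measurable M"
  using subordinator by (simp add: subordinator_def)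

lemma AE_sub: "AE \<omega> in M. \<xi> 0 \<omega> = 0 \<and> (\<forall>s t. 0 \<le> s \<longrightarrow> s \<le> t \<longrightarrow> 0 \<le> \<xi> s \<omega> \<and> \<xi> s \<omega> \<le> \<xi> t \<omega>)"
proof -
  have "AE \<omega> in M. \<xi> 0 \<omega> = 0" "AE \<omega> in M. mono_on {0..} (\<lambda>t. \<xi> t \<omega>)"
    using subordinator by (auto simp: subordinator_def)
  then show ?thesis
  proof eventually_elim
    case (elim \<omega>)
    then have "\<xi> s \<omega> \<le> \<xi> t \<omega>" if "0 \<le> s" "s \<le> t" for s t
      using that by (auto simp: mono_on_def)
    then show ?case using elim(1) by force
  qed
qed

text \<open>For \<open>t = \<eta>\<close> this is the Laplace transform of one step of the walk
  \<open>\<xi> (n \<eta>)\<close>.\<close>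

definition lap :: "real \<Rightarrow> real \<Rightarrow> real" where
  "lap t l = (\<integral>\<omega>. exp (- l * \<xi> t \<omega>) \<partial>M)"

lemma integrable_exp:
  assumes "l \<ge> 0" "t \<ge> 0"
  shows "integrable M (\<lambda>\<omega>. exp (- l * \<xi> t \<omega>))"
proof (rule integrable_const_bound[where B = 1])
  show "AE \<omega> in M. norm (exp (- l * \<xi> t \<omega>)) \<le> 1"
    using AE_sub by eventually_elim (use assms in auto)
qed (use assms in measurable)

lemma lap_nonneg: "lap t l \<ge> 0"
  unfolding lap_def by (rule Bochner_Integration.integral_nonneg) simp

lemma lap_le_1:
  assumes "l \<ge> 0" "t \<ge> 0"
  shows "lap t l \<le> 1"
  unfolding lap_def
proof (rule integral_le_const[OF integrable_exp[OF assms]])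
  show "AE \<omega> in M. exp (- l * \<xi> t \<omega>) \<le> 1"
    using AE_sub by eventually_elim (use assms in auto)
qed

lemma lap_increment:
  assumes "s \<ge> 0" "t \<ge> 0"
  shows "(\<integral>\<omega>. exp (- l * (\<xi> (s + t) \<omega> - \<xi> s \<omega>)) \<partial>M) = lap t l"
proof -
  have "(\<integral>\<omega>. exp (- l * (\<xi> (s + t) \<omega> - \<xi> s \<omega>)) \<partial>M) =
      (\<integral>x. exp (- l * x) \<partial>distr M borel (\<lambda>\<omega>. \<xi> (s + t) \<omega> - \<xi> s \<omega>))"
    using assms by (subst integral_distr) auto
  also have "distr M borel (\<lambda>\<omega>. \<xi> (s + t) \<omega> - \<xi> s \<omega>) = distr M borel (\<lambda>\<omega>. \<xi> t \<omega> - \<xi> 0 \<omega>)"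
    using subordinator assms by (simp add: subordinator_def)
  also have "(\<integral>x. exp (- l * x) \<partial>\<dots>) = (\<integral>\<omega>. exp (- l * (\<xi> t \<omega> - \<xi> 0 \<omega>)) \<partial>M)"
    using assms by (subst integral_distr) auto
  also have "\<dots> = lap t l"
    unfolding lap_def
  proof (rule integral_cong_AE)
    show "AE \<omega> in M. exp (- l * (\<xi> t \<omega> - \<xi> 0 \<omega>)) = exp (- l * \<xi> t \<omega>)"
      using AE_sub by eventually_elim simp
  qed (use assms in measurable)
  finally show ?thesis .
qed

lemma lap_prod:
  assumes "\<eta> > 0" "\<And>i. c i \<ge> 0"
  shows "(\<integral>\<omega>. (\<Prod>i<n. exp (- c i * (\<xi> (real (Suc i) * \<eta>) \<omega> - \<xi> (real i * \<eta>) \<omega>))) \<partial>M) = (\<Prod>i<n. lap \<eta> (c i))"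
    "integrable M (\<lambda>\<omega>. \<Prod>i<n. exp (- c i * (\<xi> (real (Suc i) * \<eta>) \<omega> - \<xi> (real i * \<eta>) \<omega>)))"
proof -
  let ?D = "\<lambda>i \<omega>. \<xi> (real (Suc i) * \<eta>) \<omega> - \<xi> (real i * \<eta>) \<omega>"
  have "indep_vars (\<lambda>_. borel) ?D {..<n}"
    using subordinator assms unfolding subordinator_def
    by (elim conjE allE[of _ "\<lambda>i. real i * \<eta>"]) (auto simp: incseq_def mult_right_mono)
  then have indep: "indep_vars (\<lambda>_. borel) (\<lambda>i \<omega>. exp (- c i * ?D i \<omega>)) {..<n}"
    by (rule indep_vars_compose2) auto
  have int: "integrable M (\<lambda>\<omega>. exp (- c i * ?D i \<omega>))" for i
  proof (rule integrable_const_bound[where B = 1])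
    have step: "0 \<le> real i * \<eta>" "real i * \<eta> \<le> real (Suc i) * \<eta>"
      using assms by (simp_all add: mult_right_mono)
    show "AE \<omega> in M. norm (exp (- c i * ?D i \<omega>)) \<le> 1"
      using AE_sub
      by eventually_elim (use assms(2) step in \<open>auto intro!: mult_nonneg_nonneg simp del: of_nat_Suc\<close>)
  qed (use assms in \<open>auto intro!: borel_measurable_exp borel_measurable_times borel_measurable_diff measurable_sub simp del: of_nat_Suc\<close>)
  have "(\<integral>\<omega>. exp (- c i * ?D i \<omega>) \<partial>M) = lap \<eta> (c i)" for i
    using lap_increment[of "real i * \<eta>" \<eta> "c i"] assms by (simp add: algebra_simps)
  then show "(\<integral>\<omega>. (\<Prod>i<n. exp (- c i * ?D i \<omega>)) \<partial>M) = (\<Prod>i<n. lap \<eta> (c i))"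
    using indep_vars_lebesgue_integral[OF _ indep int] by simp
  show "integrable M (\<lambda>\<omega>. \<Prod>i<n. exp (- c i * ?D i \<omega>))"
    using indep_vars_integrable[OF _ indep int] by simp
qed

text \<open>In terms of increments, the first \<open>n\<close> enter both factors and carry the
  weight \<open>l + q\<close>, while the last one carries only \<open>l\<close>; independence
  factorizes the expectation.\<close>

lemma lap_two_times:
  assumes "\<eta> > 0" "l \<ge> 0" "q \<ge> 0"
  shows "(\<integral>\<omega>. exp (- l * \<xi> (real (Suc n) * \<eta>) \<omega>) * exp (- q * \<xi> (real n * \<eta>) \<omega>) \<partial>M) = lap \<eta> (l + q) ^ n * lap \<eta> l"
proof -
  let ?c = "\<lambda>i. if i < n then l + q else l"
  let ?D = "\<lambda>i \<omega>. \<xi> (real (Suc i) * \<eta>) \<omega> - \<xi> (real i * \<eta>) \<omega>"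
  have "(\<integral>\<omega>. exp (- l * \<xi> (real (Suc n) * \<eta>) \<omega>) * exp (- q * \<xi> (real n * \<eta>) \<omega>) \<partial>M) =
      (\<integral>\<omega>. (\<Prod>i<Suc n. exp (- ?c i * ?D i \<omega>)) \<partial>M)"
  proof (rule integral_cong_AE)
    show "AE \<omega> in M. exp (- l * \<xi> (real (Suc n) * \<eta>) \<omega>) * exp (- q * \<xi> (real n * \<eta>) \<omega>) =
        (\<Prod>i<Suc n. exp (- ?c i * ?D i \<omega>))"
      using AE_sub
    proof eventually_elim
      case (elim \<omega>)
      have "(\<Sum>i<n. ?D i \<omega>) = \<xi> (real n * \<eta>) \<omega>"
        using elim sum_lessThan_telescope[of "\<lambda>i. \<xi> (real i * \<eta>) \<omega>" n] by simp
      moreover have "(\<Sum>i<n. - ?c i * ?D i \<omega>) = - (l + q) * (\<Sum>i<n. ?D i \<omega>)"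
        unfolding sum_distrib_left by (rule sum.cong) auto
      ultimately have "(\<Sum>i<Suc n. - ?c i * ?D i \<omega>) = - (l + q) * \<xi> (real n * \<eta>) \<omega> + - l * ?D n \<omega>"
        by (simp only: sum.lessThan_Suc less_irrefl if_False)
      then show ?case
        by (subst exp_sum[symmetric]) (auto simp: exp_add[symmetric] algebra_simps simp del: of_nat_Suc)
    qed
  qed (use assms in \<open>auto intro!: borel_measurable_exp borel_measurable_times borel_measurable_diff borel_measurable_prod measurable_sub simp del: of_nat_Suc\<close>)
  also have "\<dots> = (\<Prod>i<Suc n. lap \<eta> (?c i))"
    by (rule lap_prod) (use assms in auto)
  also have "\<dots> = lap \<eta> (l + q) ^ n * lap \<eta> l" by simp
  finally show ?thesis .
qed

lemma lap_power:
  assumes "\<eta> > 0" "l \<ge> 0"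
  shows "lap (real n * \<eta>) l = lap \<eta> l ^ n"
proof (cases n)
  case 0
  have "lap 0 l = (\<integral>\<omega>. 1 \<partial>M)"
    unfolding lap_def
  proof (rule integral_cong_AE)
    show "AE \<omega> in M. exp (- l * \<xi> 0 \<omega>) = 1"
      using AE_sub by eventually_elim simp
  qed auto
  with 0 show ?thesis by (simp add: prob_space)
next
  case (Suc k)
  then show ?thesis
    using lap_two_times[OF assms, of 0 k] by (simp add: lap_def)
qed

text \<open>Integrating \<open>l * exp (- l * y)\<close> over the levels \<open>y\<close> crossed by
  step \<open>n\<close> leaves the difference of exponentials. The expectation is thus the share of
  step \<open>n\<close> in the renewal identity, and it forms a geometric sequence in
  \<open>n\<close>.\<close>

lemma nn_integral_exp_step:
  assumes "\<eta> > 0" "l > 0" "q \<ge> 0"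
  shows "(\<integral>\<^sup>+\<omega>. ennreal (exp (- q * \<xi> (real n * \<eta>) \<omega>) * (exp (- l * \<xi> (real n * \<eta>) \<omega>) - exp (- l * \<xi> (real (Suc n) * \<eta>) \<omega>))) \<partial>M)
    = ennreal (lap \<eta> (l + q) ^ n * (1 - lap \<eta> l))"
proof -
  let ?f = "\<lambda>\<omega>. exp (- (l + q) * \<xi> (real n * \<eta>) \<omega>)"
  let ?g = "\<lambda>\<omega>. exp (- l * \<xi> (real (Suc n) * \<eta>) \<omega>) * exp (- q * \<xi> (real n * \<eta>) \<omega>)"
  have meas: "?g \<in> borel_measurable M"
    using assms by (auto intro!: borel_measurable_exp borel_measurable_times measurable_sub simp del: of_nat_Suc)
  have step: "real n * \<eta> \<le> real (Suc n) * \<eta>" using assms by (simp add: mult_right_mono)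
  have f: "integrable M ?f" by (rule integrable_exp) (use assms in auto)
  have g: "integrable M ?g"
  proof (rule integrable_const_bound[where B = 1, OF _ meas])
    show "AE \<omega> in M. norm (?g \<omega>) \<le> 1"
      using AE_sub by eventually_elim (use assms in \<open>auto simp: mult_le_one simp del: of_nat_Suc\<close>)
  qed
  have "(\<integral>\<^sup>+\<omega>. ennreal (exp (- q * \<xi> (real n * \<eta>) \<omega>) * (exp (- l * \<xi> (real n * \<eta>) \<omega>) - exp (- l * \<xi> (real (Suc n) * \<eta>) \<omega>))) \<partial>M)
      = (\<integral>\<^sup>+\<omega>. ennreal (?f \<omega> - ?g \<omega>) \<partial>M)"
    by (intro nn_integral_cong arg_cong[where f = ennreal]) (simp add: algebra_simps exp_add[symmetric] del: of_nat_Suc)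
  also have "\<dots> = ennreal (\<integral>\<omega>. ?f \<omega> - ?g \<omega> \<partial>M)"
  proof (rule nn_integral_eq_integral)
    show "integrable M (\<lambda>\<omega>. ?f \<omega> - ?g \<omega>)" using f g by simp
    show "AE \<omega> in M. 0 \<le> ?f \<omega> - ?g \<omega>"
      using AE_sub
    proof eventually_elim
      case (elim \<omega>)
      then have "\<xi> (real n * \<eta>) \<omega> \<le> \<xi> (real (Suc n) * \<eta>) \<omega>"
        using step assms by (simp del: of_nat_Suc)
      then have "l * \<xi> (real n * \<eta>) \<omega> \<le> l * \<xi> (real (Suc n) * \<eta>) \<omega>"
        using assms by (simp del: of_nat_Suc)
      then show ?case by (simp add: exp_add[symmetric] algebra_simps del: of_nat_Suc)
    qed
  qed
  also have "(\<integral>\<omega>. ?f \<omega> - ?g \<omega> \<partial>M) = lap (real n * \<eta>) (l + q) - lap \<eta> (l + q) ^ n * lap \<eta> l"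
    using lap_two_times[of \<eta> l q n] assms f g by (simp add: lap_def del: of_nat_Suc)
  also have "\<dots> = lap \<eta> (l + q) ^ n * (1 - lap \<eta> l)"
    using lap_power[of \<eta> "l + q" n] assms by (simp add: right_diff_distrib)
  finally show ?thesis .
qed

text \<open>
  The left-hand side is the integral over \<open>y\<close> of \<open>l exp (- l y)\<close> times the expectation of
  \<open>exp (- q S)\<close>, where \<open>S\<close> is the last value not exceeding \<open>y\<close> of the walk
  \<open>\<xi> (n \<eta>)\<close>. Where no long jump straddles \<open>y\<close>, \<open>S\<close> is at least \<open>(1 - \<epsilon>) y\<close>.
\<close>

lemma lap_ratio_le:
  assumes "\<eta> > 0" "l > 0" "q \<ge> 0" "0 < \<epsilon>" "\<epsilon> < 1" "\<rho> \<ge> 0" "y0 \<ge> 0"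
    and jump: "\<And>y. y \<ge> y0 \<Longrightarrow> measure M {\<omega> \<in> space M. \<exists>n::nat. \<xi> (real n * \<eta>) \<omega> < (1 - \<epsilon>) * y \<and>
      y < \<xi> (real (Suc n) * \<eta>) \<omega>} \<le> \<rho>"
    and "lap \<eta> (l + q) < 1"
  shows "(1 - lap \<eta> l) / (1 - lap \<eta> (l + q)) \<le> l / (l + q * (1 - \<epsilon>)) + \<rho> + l * y0"
proof -
  define S where "S n = \<xi> (real n * \<eta>)" for n
  have S [measurable]: "S n \<in> borel_measurable M" for n
    unfolding S_def by (rule measurable_sub) (use assms in simp)
  have AE_S: "AE \<omega> in M. (\<forall>n. 0 \<le> S n \<omega>) \<and> mono (\<lambda>n. S n \<omega>)"
    using AE_sub
  proof eventually_elim
    case (elim \<omega>)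
    then show ?case unfolding S_def mono_def using assms by (auto simp: mult_right_mono)
  qed
  let ?B = "\<lambda>y. {\<omega> \<in> space M. \<exists>n. S n \<omega> < (1 - \<epsilon>) * y \<and> y < S (Suc n) \<omega>}"
  have B [measurable]: "?B y \<in> sets M" for y by measurable
  \<comment> \<open>Almost surely at most one summand is nonzero, namely the one whose step
    straddles \<open>y\<close>.\<close>
  define G where "G \<omega> y = (\<Sum>n. ennreal (exp (- q * S n \<omega>)) * (if S n \<omega> \<le> y \<and> y < S (Suc n) \<omega> then ennreal (l * exp (- l * y)) else 0))" for \<omega> y
  have G: "(\<lambda>(\<omega>, y). G \<omega> y) \<in> borel_measurable (M \<Otimes>\<^sub>M lborel)"
    unfolding G_def by measurable
  interpret pair_sigma_finite M lborel ..
  have inner: "AE \<omega> in M. (\<integral>\<^sup>+y. G \<omega> y \<partial>lborel) =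
      (\<Sum>n. ennreal (exp (- q * S n \<omega>) * (exp (- l * S n \<omega>) - exp (- l * S (Suc n) \<omega>))))"
    using AE_S
  proof eventually_elim
    case (elim \<omega>)
    have "(\<integral>\<^sup>+y. G \<omega> y \<partial>lborel) = (\<Sum>n. ennreal (exp (- q * S n \<omega>)) * (\<integral>\<^sup>+y. (if S n \<omega> \<le> y \<and> y < S (Suc n) \<omega> then ennreal (l * exp (- l * y)) else 0) \<partial>lborel))"
      unfolding G_def by (subst nn_integral_suminf) (auto simp: nn_integral_cmult)
    also have "\<dots> = (\<Sum>n. ennreal (exp (- q * S n \<omega>)) * ennreal (exp (- l * S n \<omega>) - exp (- l * S (Suc n) \<omega>)))"
      using elim assms by (subst nn_integral_exp_Ico) (auto simp: mono_def)
    finally show ?case by (simp add: ennreal_mult')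
  qed
  \<comment> \<open>The quotient is the sum of the geometric series of expected step contributions;
    exchanging the integrals turns it into an integral over the level \<open>y\<close>.\<close>
  have "ennreal ((1 - lap \<eta> l) / (1 - lap \<eta> (l + q))) = (\<Sum>n. ennreal (lap \<eta> (l + q) ^ n * (1 - lap \<eta> l)))"
  proof (rule suminf_ennreal_eq[symmetric])
    show "0 \<le> lap \<eta> (l + q) ^ n * (1 - lap \<eta> l)" for n
      using lap_nonneg lap_le_1[of l \<eta>] assms by simp
    show "(\<lambda>n. lap \<eta> (l + q) ^ n * (1 - lap \<eta> l)) sums ((1 - lap \<eta> l) / (1 - lap \<eta> (l + q)))"
      using sums_mult2[OF geometric_sums[of "lap \<eta> (l + q)"], of "1 - lap \<eta> l"] lap_nonneg[of \<eta> "l + q"] assms by simp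
  qed
  also have "\<dots> = (\<integral>\<^sup>+\<omega>. (\<Sum>n. ennreal (exp (- q * S n \<omega>) * (exp (- l * S n \<omega>) - exp (- l * S (Suc n) \<omega>)))) \<partial>M)"
    unfolding nn_integral_exp_step[OF assms(1-3), folded S_def, symmetric]
    by (rule nn_integral_suminf[symmetric]) measurable
  also have "\<dots> = (\<integral>\<^sup>+\<omega>. (\<integral>\<^sup>+y. G \<omega> y \<partial>lborel) \<partial>M)"
    by (rule nn_integral_cong_AE) (use inner in eventually_elim, simp)
  also have "\<dots> = (\<integral>\<^sup>+y. (\<integral>\<^sup>+\<omega>. G \<omega> y \<partial>M) \<partial>lborel)"
    by (rule Fubini'[OF G, symmetric])
  \<comment> \<open>The first term covers paths whose last value below \<open>y\<close> is at least
    \<open>(1 - \<epsilon>) * y\<close>, the second the long jumps over levels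
    \<open>y \<ge> y0\<close>, and the third the levels up to \<open>y0\<close>, where the
    probability is only bounded by \<open>1\<close>.\<close>
  also have "\<dots> \<le> (\<integral>\<^sup>+y. ennreal (l * exp (- (l + q * (1 - \<epsilon>)) * y)) * indicator {0..} y
      + ennreal (l * \<rho> * exp (- l * y)) * indicator {0..} y + ennreal l * indicator {0..y0} y \<partial>lborel)"
  proof (rule nn_integral_mono)
    fix y :: real
    have "(\<integral>\<^sup>+\<omega>. G \<omega> y \<partial>M) \<le> (\<integral>\<^sup>+\<omega>. ennreal (l * exp (- (l + q * (1 - \<epsilon>)) * y)) * indicator {0..} y
        + ennreal (l * exp (- l * y)) * indicator {0..} y * indicator (?B y) \<omega> \<partial>M)"
    proof (rule nn_integral_mono_AE)
      show "AE \<omega> in M. G \<omega> y \<le> ennreal (l * exp (- (l + q * (1 - \<epsilon>)) * y)) * indicator {0..} y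
          + ennreal (l * exp (- l * y)) * indicator {0..} y * indicator (?B y) \<omega>"
        using AE_S AE_space
      proof eventually_elim
        case (elim \<omega>)
        show ?case
        proof (cases "\<exists>n. S n \<omega> \<le> y \<and> y < S (Suc n) \<omega>")
          case False
          then have "(if S n \<omega> \<le> y \<and> y < S (Suc n) \<omega> then ennreal (l * exp (- l * y)) else 0) = 0" for n
            by auto
          then have "G \<omega> y = 0"
            unfolding G_def by (simp only: mult_zero_right suminf_zero)
          then show ?thesis by simp
        next
          case True
          then obtain n where n: "S n \<omega> \<le> y" "y < S (Suc n) \<omega>" by blast
          have "\<not> (S m \<omega> \<le> y \<and> y < S (Suc m) \<omega>)" if "m \<noteq> n" for m
          proof (cases "m < n")
            case True
            then have "S (Suc m) \<omega> \<le> S n \<omega>" using elim by (auto simp: mono_def)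
            with n show ?thesis by simp
          next
            case False
            then have "S (Suc n) \<omega> \<le> S m \<omega>" using elim that by (auto simp: mono_def)
            with n show ?thesis by simp
          qed
          then have "G \<omega> y = (\<Sum>m\<in>{n}. ennreal (exp (- q * S m \<omega>)) * (if S m \<omega> \<le> y \<and> y < S (Suc m) \<omega> then ennreal (l * exp (- l * y)) else 0))"
            unfolding G_def by (intro suminf_finite) auto
          then have Gn: "G \<omega> y = ennreal (exp (- q * S n \<omega>) * (l * exp (- l * y)))"
            using n assms by (simp add: ennreal_mult)
          have y: "y \<ge> 0" using n elim by (meson order_trans)
          show ?thesis
          proof (cases "S n \<omega> < (1 - \<epsilon>) * y")
            case True
            then have "\<omega> \<in> ?B y" using n elim by auto
            moreover have "exp (- q * S n \<omega>) \<le> 1" using elim assms by simp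
            then have "exp (- q * S n \<omega>) * (l * exp (- l * y)) \<le> 1 * (l * exp (- l * y))"
              using assms by (intro mult_right_mono) auto
            ultimately show ?thesis unfolding Gn using y by (auto intro!: add_increasing ennreal_leI)
          next
            case False
            then have "q * ((1 - \<epsilon>) * y) \<le> q * S n \<omega>"
              using assms by (intro mult_left_mono) auto
            then have "exp (- q * S n \<omega>) * exp (- l * y) \<le> exp (- (l + q * (1 - \<epsilon>)) * y)"
              by (simp add: exp_add[symmetric] algebra_simps)
            then have "exp (- q * S n \<omega>) * (l * exp (- l * y)) \<le> l * exp (- (l + q * (1 - \<epsilon>)) * y)"
              using assms by (simp add: mult.left_commute)
            then show ?thesis unfolding Gn using y by (auto intro!: add_increasing2 ennreal_leI)
          qed
        qed
      qed
    qed
    also have "\<dots> = ennreal (l * exp (- (l + q * (1 - \<epsilon>)) * y)) * indicator {0..} y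
        + ennreal (l * exp (- l * y)) * indicator {0..} y * ennreal (measure M (?B y))"
      by (subst nn_integral_add) (auto simp: nn_integral_cmult_indicator emeasure_eq_measure prob_space)
    also have "ennreal (l * exp (- l * y)) * indicator {0..} y * ennreal (measure M (?B y)) \<le>
        ennreal (l * \<rho> * exp (- l * y)) * indicator {0..} y + ennreal l * indicator {0..y0} y"
    proof (cases "0 \<le> y")
      case y: True
      show ?thesis
      proof (cases "y \<ge> y0")
        case True
        then have "l * exp (- l * y) * measure M (?B y) \<le> l * exp (- l * y) * \<rho>"
          using jump[OF True] assms by (intro mult_left_mono) (auto simp: S_def)
        then show ?thesis
          using y assms by (intro add_increasing2) (auto simp flip: ennreal_mult intro!: ennreal_leI simp: mult_ac)
      next
        case False
        have "l * exp (- l * y) * measure M (?B y) \<le> l * 1 * 1"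
          using assms y by (intro mult_mono) auto
        then show ?thesis
          using y assms False by (intro add_increasing) (auto simp flip: ennreal_mult intro!: ennreal_leI)
      qed
    qed simp
    finally show "(\<integral>\<^sup>+\<omega>. G \<omega> y \<partial>M) \<le> ennreal (l * exp (- (l + q * (1 - \<epsilon>)) * y)) * indicator {0..} y
      + ennreal (l * \<rho> * exp (- l * y)) * indicator {0..} y + ennreal l * indicator {0..y0} y"
      by (simp add: add.assoc)
  qed
  also have "\<dots> = ennreal (l / (l + q * (1 - \<epsilon>))) + ennreal (l * \<rho> / l) + ennreal l * ennreal y0"
  proof -
    have "l + q * (1 - \<epsilon>) > 0" using assms by (intro add_pos_nonneg) auto
    note nn_integral_exp_atLeast[OF this, of l] nn_integral_exp_atLeast[of l "l * \<rho>"]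
    with assms show ?thesis
      by (simp add: nn_integral_add nn_integral_cmult_indicator)
  qed
  also have "\<dots> = ennreal (l / (l + q * (1 - \<epsilon>)) + \<rho> + l * y0)"
    using assms by (simp add: ennreal_mult)
  finally show ?thesis
    using assms by (subst (asm) ennreal_le_iff) auto
qed

lemma AE_zero_if_lap_eq_1:
  assumes "l > 0" "t \<ge> 0" "lap t l = 1"
  shows "AE \<omega> in M. \<xi> t \<omega> = 0"
proof -
  have int: "integrable M (\<lambda>\<omega>. 1 - exp (- l * \<xi> t \<omega>))"
    using integrable_exp[of l t] assms by simp
  have nonneg: "AE \<omega> in M. 0 \<le> 1 - exp (- l * \<xi> t \<omega>)"
    using AE_sub by eventually_elim (use assms in auto)
  have "(\<integral>\<omega>. 1 - exp (- l * \<xi> t \<omega>) \<partial>M) = 0"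
    using integrable_exp[of l t] assms by (simp add: lap_def prob_space)
  then have "AE \<omega> in M. 1 - exp (- l * \<xi> t \<omega>) = 0"
    using integral_nonneg_eq_0_iff_AE[OF int nonneg] by simp
  then show ?thesis
    by eventually_elim (use assms in auto)
qed

text \<open>\<open>lap_power\<close> propagates the value \<open>1\<close> of the Laplace transform
  from time \<open>1\<close> to all integer times, and monotonicity of the paths fills the gaps
  between them.\<close>

lemma AE_zero_if_zero_at_1:
  assumes "AE \<omega> in M. \<xi> 1 \<omega> = 0"
  shows "AE \<omega> in M. \<forall>u\<ge>0. \<xi> u \<omega> = 0"
proof -
  have "lap 1 1 = (\<integral>\<omega>. 1 \<partial>M)"
    unfolding lap_def by (rule integral_cong_AE) (use assms in auto)
  then have "lap (real n) 1 = 1" for n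
    using lap_power[of 1 1 n] by (simp add: prob_space)
  then have "AE \<omega> in M. \<xi> (real n) \<omega> = 0" for n
    by (intro AE_zero_if_lap_eq_1[of 1]) auto
  then have "AE \<omega> in M. \<forall>n. \<xi> (real n) \<omega> = 0"
    by (simp add: AE_all_countable)
  with AE_sub show ?thesis
  proof eventually_elim
    case (elim \<omega>)
    show ?case
    proof (intro allI impI)
      fix u :: real assume "u \<ge> 0"
      moreover obtain n where "u \<le> real n" using real_arch_simple by blast
      ultimately have "0 \<le> \<xi> u \<omega>" "\<xi> u \<omega> \<le> \<xi> (real n) \<omega>" using elim(1) by auto
      with elim(2) show "\<xi> u \<omega> = 0" by (metis order_antisym)
    qed
  qed
qed

lemma lap_pos:
  assumes "l \<ge> 0" "t \<ge> 0"
  shows "lap t l > 0"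
proof -
  have "lap t l \<noteq> 0"
  proof
    assume "lap t l = 0"
    then have "AE \<omega> in M. exp (- l * \<xi> t \<omega>) = 0"
      using integral_nonneg_eq_0_iff_AE[OF integrable_exp[OF assms]] by (simp add: lap_def)
    then show False by simp
  qed
  with lap_nonneg[of t l] show ?thesis by simp
qed

section \<open>From the walk to the Laplace exponent\<close>

abbreviation \<phi> :: "real \<Rightarrow> real" where
  "\<phi> \<equiv> laplace_exponent M \<xi>"

lemma lap_eq_exp:
  assumes "k > 0" "l \<ge> 0"
  shows "lap (1 / real k) l = exp (- \<phi> l / real k)"
proof -
  have "lap 1 l = exp (- \<phi> l)"
    using lap_pos[of l 1] assms by (simp add: laplace_exponent_def lap_def)
  then have "lap (1 / real k) l ^ k = exp (- \<phi> l / real k) ^ k"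
    using lap_power[of "1 / real k" l k] assms by (simp add: exp_of_nat_mult[symmetric])
  then show ?thesis
    by (rule power_eq_imp_eq_base) (use assms lap_nonneg in auto)
qed

lemma laplace_exponent_mono:
  assumes "0 \<le> l" "l \<le> l'"
  shows "\<phi> l \<le> \<phi> l'"
proof -
  have "lap 1 l' \<le> lap 1 l"
    unfolding lap_def
  proof (rule integral_mono_AE)
    show "AE \<omega> in M. exp (- l' * \<xi> 1 \<omega>) \<le> exp (- l * \<xi> 1 \<omega>)"
      using AE_sub by eventually_elim (use assms in \<open>auto intro!: mult_right_mono\<close>)
  qed (use assms integrable_exp[of _ 1] in auto)
  then show ?thesis
    using lap_eq_exp[of 1 l] lap_eq_exp[of 1 l'] assms by simp
qed

text \<open>This is Jensen's inequality for the power \<open>c\<close>, obtained from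
  \<open>exp_chord_le\<close> with \<open>\<theta> = 1 / c\<close>. The factor
  \<open>exp (\<phi> l)\<close> normalizes the mean of \<open>exp (- l * \<xi> 1 \<omega>)\<close>
  to \<open>1\<close>, so that the chord bound loses nothing.\<close>

lemma laplace_exponent_scale_le:
  assumes "c \<ge> 1" "l \<ge> 0"
  shows "\<phi> (c * l) \<le> c * \<phi> l"
proof -
  have lap: "lap 1 l = exp (- \<phi> l)" "lap 1 (c * l) = exp (- \<phi> (c * l))"
    using lap_eq_exp[of 1] assms by auto
  have "exp (\<phi> l) * lap 1 l \<le> (\<integral>\<omega>. exp (c * \<phi> l) / c * exp (- (c * l) * \<xi> 1 \<omega>) + (1 - 1 / c) \<partial>M)"
    unfolding lap_def integral_mult_right_zero[symmetric]
  proof (rule integral_mono)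
    fix \<omega>
    have "exp (\<phi> l) * exp (- l * \<xi> 1 \<omega>) = exp (1 / c * (c * \<phi> l - c * l * \<xi> 1 \<omega>))"
      using assms by (simp add: exp_add[symmetric] field_simps)
    also have "\<dots> \<le> 1 / c * exp (c * \<phi> l - c * l * \<xi> 1 \<omega>) + (1 - 1 / c)"
      by (rule exp_chord_le) (use assms in auto)
    also have "exp (c * \<phi> l - c * l * \<xi> 1 \<omega>) = exp (c * \<phi> l) * exp (- (c * l) * \<xi> 1 \<omega>)"
      by (simp add: exp_add[symmetric])
    finally show "exp (\<phi> l) * exp (- l * \<xi> 1 \<omega>) \<le> exp (c * \<phi> l) / c * exp (- (c * l) * \<xi> 1 \<omega>) + (1 - 1 / c)"
      by simp
  qed (use assms integrable_exp[of l 1] integrable_exp[of "c * l" 1] in auto)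
  also have "\<dots> = exp (c * \<phi> l) / c * lap 1 (c * l) + (1 - 1 / c)"
    using integrable_exp[of "c * l" 1] assms by (simp add: lap_def prob_space)
  finally have "1 \<le> exp (c * \<phi> l - \<phi> (c * l)) / c + (1 - 1 / c)"
    unfolding lap by (simp add: exp_add[symmetric])
  then have "1 \<le> exp (c * \<phi> l - \<phi> (c * l))"
    using assms by (simp add: field_simps)
  then show ?thesis by simp
qed

text \<open>The function \<open>1 - exp (- x / k)\<close> of \<open>x\<close> is concave and
  vanishes at \<open>0\<close>, so passing to its values can only raise the quotient of a smaller
  argument by a larger one. This carries bounds for one step of the walk over to the
  exponent.\<close>

lemma laplace_exponent_ratio_le:
  assumes "k > 0" "0 \<le> l" "l \<le> l'" "\<phi> l' > 0"
  shows "\<phi> l / \<phi> l' \<le> (1 - lap (1 / real k) l) / (1 - lap (1 / real k) l')"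
proof -
  let ?\<theta> = "\<phi> l / \<phi> l'"
  have "lap 1 l \<le> 1" using assms by (intro lap_le_1) auto
  then have "0 \<le> \<phi> l" using lap_eq_exp[of 1 l] assms by simp
  then have "0 \<le> ?\<theta>" "?\<theta> \<le> 1"
    using laplace_exponent_mono[of l l'] assms by auto
  then have "exp (?\<theta> * (- \<phi> l' / real k)) \<le> ?\<theta> * exp (- \<phi> l' / real k) + (1 - ?\<theta>)"
    by (rule exp_chord_le)
  then have "?\<theta> * (1 - lap (1 / real k) l') \<le> 1 - lap (1 / real k) l"
    using assms by (simp add: lap_eq_exp algebra_simps)
  moreover have "1 - lap (1 / real k) l' > 0"
    using assms by (simp add: lap_eq_exp)
  ultimately show ?thesis by (simp add: pos_le_divide_eq)
qed

text \<open>Steps are reciprocals of integers so that \<open>lap_eq_exp\<close> applies; the step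
  may depend on \<open>\<epsilon>\<close> and \<open>\<rho>\<close>.\<close>

definition long_jumps_rare :: bool where
  "long_jumps_rare \<longleftrightarrow> (\<forall>\<epsilon> \<rho>. 0 < \<epsilon> \<longrightarrow> \<epsilon> < 1 \<longrightarrow> \<rho> > 0 \<longrightarrow> (\<exists>k>0. eventually (\<lambda>y.
     measure M {\<omega> \<in> space M. \<exists>n::nat. \<xi> (real n * (1 / real k)) \<omega> < (1 - \<epsilon>) * y \<and>
       y < \<xi> (real (Suc n) * (1 / real k)) \<omega>} \<le> \<rho>) at_top))"

text \<open>The lower bound \<open>1 / c\<close> is \<open>laplace_exponent_scale_le\<close>. For
  the upper bound, \<open>lap_ratio_le\<close> with \<open>q = (c - 1) * l\<close> gives
  \<open>1 / (1 + (c - 1) * (1 - \<epsilon>))\<close> up to two small errors. The first quantity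
  exceeds \<open>1 / c\<close> by less than \<open>e / 3\<close>, and the errors from long jumps and
  from low levels are at most \<open>e / 3\<close> each.\<close>

lemma laplace_exponent_ratio_tendsto:
  assumes "long_jumps_rare" and pos: "\<And>l. l > 0 \<Longrightarrow> \<phi> l > 0" and "c > 1"
  shows "((\<lambda>l. \<phi> l / \<phi> (c * l)) \<longlongrightarrow> 1 / c) (at_right 0)"
proof (rule tendstoI)
  fix e :: real assume "e > 0"
  have "((\<lambda>\<epsilon>. 1 / (1 + (c - 1) * (1 - \<epsilon>))) \<longlongrightarrow> 1 / (1 + (c - 1) * (1 - 0))) (at_right 0)"
    using \<open>c > 1\<close> by (intro tendsto_intros) auto
  then have "eventually (\<lambda>\<epsilon>. 1 / (1 + (c - 1) * (1 - \<epsilon>)) < 1 / c + e / 3) (at_right 0)"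
    by (rule order_tendstoD) (use \<open>e > 0\<close> in simp)
  moreover have "eventually (\<lambda>\<epsilon>. \<epsilon> \<in> {0<..<1 :: real}) (at_right 0)"
    by (rule eventually_at_right_real) simp
  ultimately have "eventually (\<lambda>\<epsilon>. 1 / (1 + (c - 1) * (1 - \<epsilon>)) < 1 / c + e / 3 \<and> \<epsilon> \<in> {0<..<1}) (at_right 0)"
    by (rule eventually_conj)
  then obtain \<epsilon> where \<epsilon>: "1 / (1 + (c - 1) * (1 - \<epsilon>)) < 1 / c + e / 3" "0 < \<epsilon>" "\<epsilon> < 1"
    using eventually_happens'[OF trivial_limit_at_right_real] by fastforce
  obtain k y1 where k: "k > 0" and y1: "\<And>y. y \<ge> y1 \<Longrightarrow>
     measure M {\<omega> \<in> space M. \<exists>n::nat. \<xi> (real n * (1 / real k)) \<omega> < (1 - \<epsilon>) * y \<and>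
       y < \<xi> (real (Suc n) * (1 / real k)) \<omega>} \<le> e / 3"
    using assms(1)[unfolded long_jumps_rare_def, rule_format, OF \<epsilon>(2,3), of "e / 3"] \<open>e > 0\<close>
    unfolding eventually_at_top_linorder by auto
  define y0 where "y0 = max 0 y1"
  have "((\<lambda>l. l * y0) \<longlongrightarrow> 0 * y0) (at_right 0)"
    by (intro tendsto_intros)
  then have "eventually (\<lambda>l. l * y0 < e / 3) (at_right 0)"
    by (rule order_tendstoD) (use \<open>e > 0\<close> in simp)
  then show "eventually (\<lambda>l. dist (\<phi> l / \<phi> (c * l)) (1 / c) < e) (at_right 0)"
    using eventually_at_right_less[of 0]
  proof eventually_elim
    case (elim l)
    have cl: "l + (c - 1) * l = c * l" "0 < c * l" "l \<le> c * l"
      using \<open>c > 1\<close> elim by (simp_all add: algebra_simps)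
    have "\<phi> l / \<phi> (c * l) \<le> (1 - lap (1 / real k) l) / (1 - lap (1 / real k) (c * l))"
      by (rule laplace_exponent_ratio_le) (use k elim cl pos in auto)
    also have "\<dots> \<le> l / (l + (c - 1) * l * (1 - \<epsilon>)) + e / 3 + l * y0"
    proof -
      have "lap (1 / real k) (l + (c - 1) * l) < 1"
        unfolding cl(1) using pos[OF cl(2)] k cl(2) by (simp add: lap_eq_exp)
      moreover have "0 \<le> (c - 1) * l" "0 < 1 / real k" "0 \<le> e / 3" "0 \<le> y0" "l > 0"
        using k elim \<open>e > 0\<close> \<open>c > 1\<close> by (simp_all add: y0_def)
      moreover have "y \<ge> y1" if "y \<ge> y0" for y
        using that by (simp add: y0_def)
      ultimately show ?thesis
        using lap_ratio_le[of "1 / real k" l "(c - 1) * l" \<epsilon> "e / 3" y0] y1 \<epsilon>(2,3) unfolding cl(1) by blast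
    qed
    also have "l / (l + (c - 1) * l * (1 - \<epsilon>)) = 1 / (1 + (c - 1) * (1 - \<epsilon>))"
    proof -
      have "l + (c - 1) * l * (1 - \<epsilon>) = l * (1 + (c - 1) * (1 - \<epsilon>))"
        by (simp add: algebra_simps)
      then show ?thesis using elim by (simp add: divide_simps)
    qed
    finally have "\<phi> l / \<phi> (c * l) < 1 / c + e"
      using \<epsilon>(1) elim(1) by simp
    moreover have "1 / c \<le> \<phi> l / \<phi> (c * l)"
      using laplace_exponent_scale_le[of c l] pos[OF cl(2)] elim \<open>c > 1\<close> by (simp add: field_simps)
    ultimately show ?case by (simp add: dist_real_def)
  qed
qed

lemma regularly_varying_if_long_jumps_rare:
  assumes "long_jumps_rare" and pos: "\<And>l. l > 0 \<Longrightarrow> \<phi> l > 0"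
  shows "regularly_varying_at_0 \<phi> 1"
  unfolding regularly_varying_at_0_def
proof (intro allI impI)
  fix c :: real assume "c > 0"
  consider "c > 1" | "c = 1" | "c < 1" by linarith
  then show "((\<lambda>l. \<phi> (c * l) / \<phi> l) \<longlongrightarrow> c powr 1) (at_right 0)"
  proof cases
    case 1
    have "((\<lambda>l. inverse (\<phi> l / \<phi> (c * l))) \<longlongrightarrow> inverse (1 / c)) (at_right 0)"
      using 1 by (intro tendsto_inverse laplace_exponent_ratio_tendsto assms) auto
    then show ?thesis using \<open>c > 0\<close> by (simp add: inverse_eq_divide)
  next
    case 2
    have "eventually (\<lambda>l. \<phi> (c * l) / \<phi> l = c powr 1) (at_right 0)"
      using eventually_at_right_less[of 0] by eventually_elim (use 2 pos in force)
    then show ?thesis by (rule tendsto_eventually)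
  next
    case 3
    \<comment> \<open>For \<open>c < 1\<close> the limit for the factor \<open>1 / c\<close> is used
      with \<open>c * l\<close> in place of \<open>l\<close>.\<close>
    have "filterlim (\<lambda>l. c * l) (at_right 0) (at_right 0)"
    proof (rule tendsto_imp_filterlim_at_right)
      have "((\<lambda>l. c * l) \<longlongrightarrow> c * 0) (at_right 0)" by (intro tendsto_intros)
      then show "((\<lambda>l. c * l) \<longlongrightarrow> 0) (at_right 0)" by simp
      show "eventually (\<lambda>l. c * l > 0) (at_right 0)"
        using eventually_at_right_less[of 0] by eventually_elim (use \<open>c > 0\<close> in simp)
    qed
    from filterlim_compose[OF laplace_exponent_ratio_tendsto[OF assms, of "1 / c"] this]
    show ?thesis using 3 \<open>c > 0\<close> by simp
  qed
qed

end

section \<open>Regular variation from the growth exponent\<close>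

context increasing_pssmp
begin

text \<open>The long-jump bound leaves the term
  \<open>tail (2 * \<eta> * 4 powr \<alpha>) 2\<close>, which \<open>tail_at_0\<close> makes small
  when the step \<open>\<eta> = 1 / k\<close> is small.\<close>

lemma regularly_varying_if_growth_exponent:
  assumes "growth_exponent" "\<alpha> > 0" "subordinator (P 1) (lamperti \<alpha> X)"
  shows "regularly_varying_at_0 (laplace_exponent (P 1) (lamperti \<alpha> X)) 1"
proof -
  interpret S: subordinator_process "P 1" "lamperti \<alpha> X"
    by unfold_locales (rule assms)
  show ?thesis
  proof (rule S.regularly_varying_if_long_jumps_rare)
    show "S.long_jumps_rare"
      unfolding S.long_jumps_rare_def
    proof (intro allI impI)
      fix \<epsilon> \<rho> :: real assume *: "0 < \<epsilon>" "\<epsilon> < 1" "\<rho> > 0"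
      obtain r where r: "r > 0" "tail r 2 < \<rho> / 2"
        using tail_at_0[of 2 "\<rho> / 2"] * by auto
      obtain k :: nat where k: "k > 0" "1 / real k < r / (2 * 4 powr \<alpha>)"
        using ex_inverse_of_nat_less[of "r / (2 * 4 powr \<alpha>)"] r by (auto simp: inverse_eq_divide)
      have "tail (2 * (1 / real k) * 4 powr \<alpha>) 2 \<le> tail r 2"
        using k by (intro tail_mono) (simp_all add: field_simps)
      moreover have "eventually (\<lambda>y. measure (P 1) {\<omega> \<in> \<Omega>. \<exists>n::nat. lamperti \<alpha> X (real n * (1 / real k)) \<omega> < (1 - \<epsilon>) * y \<and>
          y < lamperti \<alpha> X (real (Suc n) * (1 / real k)) \<omega>} \<le> tail (2 * (1 / real k) * 4 powr \<alpha>) 2 + \<rho> / 2) at_top"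
        using k by (intro eventually_long_jump_prob_le assms * S.measurable_sub) (use * in auto)
      ultimately show "\<exists>k>0. eventually (\<lambda>y. measure (P 1) {\<omega> \<in> space (P 1). \<exists>n::nat. lamperti \<alpha> X (real n * (1 / real k)) \<omega> < (1 - \<epsilon>) * y \<and>
          y < lamperti \<alpha> X (real (Suc n) * (1 / real k)) \<omega>} \<le> \<rho>) at_top"
        using k r unfolding space_P1 by (intro exI[of _ k] conjI) (auto elim!: eventually_mono)
    qed
    \<comment> \<open>Otherwise the subordinator would vanish at time \<open>1\<close>, hence at all
      times, and \<open>X\<close> would be constant, against the growth exponent.\<close>
    show "laplace_exponent (P 1) (lamperti \<alpha> X) l > 0" if "l > 0" for l
    proof -
      have "\<not> (AE \<omega> in P 1. lamperti \<alpha> X 1 \<omega> = 0)"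
      proof
        assume "AE \<omega> in P 1. lamperti \<alpha> X 1 \<omega> = 0"
        from S.AE_zero_if_zero_at_1[OF this] have "AE \<omega> in P 1. \<forall>t\<ge>0. X t \<omega> \<le> X 0 \<omega>"
          using AE_space
        proof eventually_elim
          case (elim \<omega>)
          show ?case
          proof (rule ccontr)
            assume "\<not> ?thesis"
            then obtain t where "t \<ge> 0" "X t \<omega> > X 0 \<omega>" by (auto simp: not_le)
            with lamperti_pos_if_X_increases[of \<omega> t] elim assms obtain u where "u > 0" "lamperti \<alpha> X u \<omega> > 0"
              by auto
            with elim show False by (metis less_irrefl less_imp_le)
          qed
        qed
        with growth_exponent_not_const assms show False by blast
      qed
      then have "S.lap 1 l \<noteq> 1"
        using S.AE_zero_if_lap_eq_1[of l 1] that by auto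
      then have "S.lap 1 l < 1"
        using S.lap_le_1[of l 1] that by simp
      then show ?thesis
        using S.lap_eq_exp[of 1 l] that by simp
    qed
  qed
qed

end

section \<open>Limits on a given scale\<close>

locale pssmp_limit = increasing_pssmp \<alpha> P X \<Omega> + N: prob_space N
  for \<alpha> and P :: "real \<Rightarrow> 'a measure" and X \<Omega> and N :: "'b measure" +
  fixes h :: "real \<Rightarrow> real" and Y :: "'b \<Rightarrow> real"
  assumes alpha_pos: "\<alpha> > 0"
    and h_pos: "t > 0 \<Longrightarrow> h t > 0"
    and measurable_Y [measurable]: "Y \<in> borel_measurable N"
    and conv: "weak_conv_at_top (\<lambda>t. distr (P 1) borel (\<lambda>\<omega>. ln (X t \<omega> / t powr (1 / \<alpha>)) / h t))
           (distr N borel Y)"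
begin

definition limit_tail :: "real \<Rightarrow> real" where
  "limit_tail y = measure N {\<omega> \<in> space N. Y \<omega> > y}"

lemma limit_tail_bounds: "0 \<le> limit_tail y" "limit_tail y \<le> 1"
  by (simp_all add: limit_tail_def)

lemma eventually_measurable:
  "eventually (\<lambda>t. (\<lambda>\<omega>. ln (X t \<omega> / t powr (1 / \<alpha>)) / h t) \<in> borel_measurable (P 1)) at_top"
  using eventually_gt_at_top[of 0] by eventually_elim (rule measurable_normalized)

lemma eventually_tail:
  assumes "u < v" "e > 0"
  shows eventually_tail_le: "eventually (\<lambda>t. tail t (exp (v * h t + ln t / \<alpha>)) \<le> limit_tail u + e) at_top"
    and eventually_tail_ge: "eventually (\<lambda>t. tail t (exp (u * h t + ln t / \<alpha>)) \<ge> limit_tail v - e) at_top"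
proof -
  have *: "measure (P 1) {\<omega> \<in> space (P 1). ln (X t \<omega> / t powr (1 / \<alpha>)) / h t > y} =
      tail t (exp (y * h t + ln t / \<alpha>))" if "t > 0" for t y
    unfolding tail_exp[OF less_imp_le[OF that]]
    by (intro arg_cong[where f = "measure (P 1)"])
       (use that h_pos[OF that] in \<open>auto simp: ln_normalized field_simps\<close>)
  note conv_tails = prob_space_P[OF zero_less_one] N.prob_space_axioms measurable_Y eventually_measurable conv assms
  show "eventually (\<lambda>t. tail t (exp (v * h t + ln t / \<alpha>)) \<le> limit_tail u + e) at_top"
    using weak_conv_at_top_tail_le[OF conv_tails] eventually_gt_at_top[of 0]
    by eventually_elim (simp only: * limit_tail_def)
  show "eventually (\<lambda>t. tail t (exp (u * h t + ln t / \<alpha>)) \<ge> limit_tail v - e) at_top"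
    using weak_conv_at_top_tail_ge[OF conv_tails] eventually_gt_at_top[of 0]
    by eventually_elim (simp only: * limit_tail_def)
qed

section \<open>Scales \<open>h\<close> that dominate the logarithm\<close>

context
  assumes fast: "filterlim (\<lambda>t. h t / ln t) at_top at_top"
begin

lemma eventually_h_ge: "eventually (\<lambda>t. h t \<ge> K * ln t) at_top"
  using filterlim_at_top[THEN iffD1, OF fast, rule_format, of K] eventually_gt_at_top[of 1]
  by eventually_elim (simp add: pos_le_divide_eq)

lemma filterlim_h: "filterlim h at_top at_top"
  by (rule filterlim_at_top_mono[OF ln_at_top]) (use eventually_h_ge[of 1] in simp)

text \<open>One half of the gap between \<open>u\<close> and \<open>v\<close> is spent on weak
  convergence; the other half absorbs the centering \<open>ln t / \<alpha>\<close>, which is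
  negligible against \<open>h t\<close>.\<close>

lemma eventually_fast_tail_le:
  assumes "u < v" "e > 0"
  shows "eventually (\<lambda>t. tail t (exp (v * h t)) \<le> limit_tail u + e) at_top"
proof -
  let ?w = "(u + v) / 2"
  have "u < ?w" using assms by simp
  from eventually_tail_le[OF this \<open>e > 0\<close>] eventually_h_ge[of "2 / (\<alpha> * (v - u))"] eventually_gt_at_top[of 0]
  show ?thesis
  proof eventually_elim
    case (elim t)
    have "ln t / \<alpha> \<le> (v - u) / 2 * h t"
      using elim(2) assms alpha_pos by (simp add: field_simps)
    then have "?w * h t + ln t / \<alpha> \<le> v * h t"
      by (simp add: field_simps)
    then have "tail t (exp (v * h t)) \<le> tail t (exp (?w * h t + ln t / \<alpha>))"
      using elim(3) by (intro tail_antimono) auto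
    with elim(1) show ?case by simp
  qed
qed

lemma eventually_fast_tail_ge:
  assumes "u < v" "e > 0"
  shows "eventually (\<lambda>t. tail t (exp (u * h t)) \<ge> limit_tail v - e) at_top"
  using eventually_tail_ge[OF assms] eventually_gt_at_top[of 1]
proof eventually_elim
  case (elim t)
  then have "tail t (exp (u * h t + ln t / \<alpha>)) \<le> tail t (exp (u * h t))"
    using alpha_pos by (intro tail_antimono) auto
  with elim(1) show ?case by simp
qed

text \<open>If \<open>X T > exp x\<close>, then either \<open>X t > exp w\<close>, or
  \<open>X t > exp y\<close> and \<open>X\<close> still grows by the factor \<open>exp 1\<close>, or
  \<open>X t \<le> exp y\<close> and \<open>X\<close> grows by the factor \<open>exp z\<close>. In
  the second case the relation between \<open>y\<close> and \<open>T\<close> shrinks the rescaled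
  time to at most \<open>1 / T\<close>. In the third the process restarts from a level at least
  \<open>1\<close>, and the Markov property gives a product.\<close>

lemma two_scale_bound:
  assumes "t \<ge> 0" "T \<ge> t" and y: "exp y \<ge> 1" and "z + y \<le> x" "w + 1 \<le> x" and "\<alpha> * y = 2 * ln T" "T > 0"
  shows "tail T (exp x) \<le> tail t (exp w) + tail (1 / T) (exp 1) + (1 - tail t (exp y)) * tail T (exp z)"
proof -
  have T: "T * exp y powr - \<alpha> = 1 / T"
  proof -
    have "exp y powr - \<alpha> = exp (- 2 * ln T)"
      using assms by (simp add: powr_def)
    also have "\<dots> = 1 / T ^ 2"
      using \<open>T > 0\<close> by (simp add: exp_minus exp_double inverse_eq_divide)
    finally show ?thesis using \<open>T > 0\<close> by (simp add: power2_eq_square)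
  qed
  have meas: "{\<omega> \<in> \<Omega>. X t \<omega> \<in> A \<and> X T \<omega> > c * X t \<omega>} \<in> sets (P 1)" if "A \<in> sets borel" for A c
  proof -
    have [measurable]: "X t \<in> borel_measurable (P 1)" "X T \<in> borel_measurable (P 1)"
      using assms by (auto intro: measurable_X)
    show ?thesis using that by (simp flip: space_P1)
  qed
  let ?A = "{\<omega> \<in> \<Omega>. X t \<omega> > exp w}"
  let ?B = "{\<omega> \<in> \<Omega>. X t \<omega> \<in> {exp y<..} \<and> X T \<omega> > exp 1 * X t \<omega>}"
  let ?C = "{\<omega> \<in> \<Omega>. X t \<omega> \<in> {1..exp y} \<and> X T \<omega> > exp z * X t \<omega>}"
  have ABC: "?A \<in> sets (P 1)" "?B \<in> sets (P 1)" "?C \<in> sets (P 1)"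
    using assms by (auto intro!: tail_sets meas simp del: greaterThan_iff atLeastAtMost_iff)
  have "tail T (exp x) \<le> measure (P 1) (?A \<union> ?B \<union> ?C)"
    unfolding tail_def
  proof (rule P1.finite_measure_mono_AE)
    show "AE \<omega> in P 1. \<omega> \<in> {\<omega> \<in> \<Omega>. exp x < X T \<omega>} \<longrightarrow> \<omega> \<in> ?A \<union> ?B \<union> ?C"
      using AE_ge_1
    proof (eventually_elim, intro impI)
      fix \<omega> assume \<omega>: "\<forall>t\<ge>0. X t \<omega> \<ge> 1" "\<omega> \<in> {\<omega> \<in> \<Omega>. exp x < X T \<omega>}"
      have "exp 1 * X t \<omega> < X T \<omega>" if "X t \<omega> \<le> exp w"
      proof -
        have "exp 1 * X t \<omega> \<le> exp (w + 1)" using that by (simp add: exp_add)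
        also have "\<dots> \<le> exp x" using assms by simp
        finally show ?thesis using \<omega> by auto
      qed
      moreover have "exp z * X t \<omega> < X T \<omega>" if "X t \<omega> \<le> exp y"
      proof -
        have "exp z * X t \<omega> \<le> exp (z + y)" using that by (simp add: exp_add)
        also have "\<dots> \<le> exp x" using assms by simp
        finally show ?thesis using \<omega> by auto
      qed
      ultimately show "\<omega> \<in> ?A \<union> ?B \<union> ?C"
        using \<omega> \<open>t \<ge> 0\<close> by (cases "X t \<omega> \<le> exp w"; cases "X t \<omega> \<le> exp y") auto
    qed
  qed (intro sets.Un ABC)
  also have "\<dots> \<le> measure (P 1) (?A \<union> ?B) + measure (P 1) ?C"
    by (intro measure_Un_le sets.Un ABC)
  also have "measure (P 1) (?A \<union> ?B) \<le> measure (P 1) ?A + measure (P 1) ?B"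
    by (intro measure_Un_le sets.Un ABC)
  also have "measure (P 1) ?B \<le> tail (1 / T) (exp 1)"
  proof -
    have "measure (P 1) ?B \<le> measure (P 1) {\<omega> \<in> \<Omega>. X t \<omega> \<in> {exp y<..}} * tail ((T - t) * exp y powr - \<alpha>) (exp 1)"
      using growth_after_le[of t "T - t" "exp y" "{exp y<..}" "exp 1"] assms alpha_pos by (auto simp: subset_iff)
    also have "\<dots> \<le> 1 * tail (T * exp y powr - \<alpha>) (exp 1)"
      using assms by (intro mult_mono tail_mono mult_right_mono) (auto simp: tail_def)
    finally show ?thesis using T by simp
  qed
  also have "measure (P 1) ?C \<le> (1 - tail t (exp y)) * tail T (exp z)"
  proof -
    have "measure (P 1) ?C \<le> measure (P 1) {\<omega> \<in> \<Omega>. X t \<omega> \<in> {1..exp y}} * tail ((T - t) * 1 powr - \<alpha>) (exp z)"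
      using growth_after_le[of t "T - t" 1 "{1..exp y}" "exp z"] assms alpha_pos by (auto simp: subset_iff)
    also have "\<dots> \<le> (1 - tail t (exp y)) * tail T (exp z)"
    proof (intro mult_mono)
      have "measure (P 1) {\<omega> \<in> \<Omega>. X t \<omega> \<in> {1..exp y}} \<le> measure (P 1) (space (P 1) - {\<omega> \<in> \<Omega>. X t \<omega> > exp y})"
        by (intro P1.finite_measure_mono sets.Diff sets.top tail_sets) (use assms in auto)
      also have "\<dots> = 1 - tail t (exp y)"
        unfolding tail_def using assms by (intro P1.prob_compl tail_sets)
      finally show "measure (P 1) {\<omega> \<in> \<Omega>. X t \<omega> \<in> {1..exp y}} \<le> 1 - tail t (exp y)" .
    qed (use assms in \<open>auto simp: tail_def intro!: tail_mono[unfolded tail_def]\<close>)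
    finally show ?thesis .
  qed
  finally show ?thesis by (simp add: tail_def)
qed

text \<open>\<open>two_scale_bound\<close> is applied with levels of order \<open>h t\<close> at
  time \<open>t\<close> and of order \<open>h (T t)\<close> at time \<open>T t\<close>; weak
  convergence turns the tails at both times into values of \<open>limit_tail\<close>. The error
  \<open>7 * e\<close> consists of \<open>2 * e\<close> from the level \<open>(m + 1) * h t\<close>,
  \<open>e\<close> from the left-hand side, \<open>e\<close> from the short time
  \<open>1 / T t\<close>, and \<open>3 * e\<close> from the product.\<close>

lemma limit_tail_recursion:
  assumes "0 < u" "u < v"
  shows "limit_tail v \<le> (1 - limit_tail v) * limit_tail u"
proof -
  have "limit_tail v \<le> (1 - limit_tail v) * limit_tail u + 7 * e" if e: "0 < e" "e < 1" for e
  proof -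
    \<comment> \<open>The chain \<open>u < y' < y < v\<close> leaves a strict gap at each use of
      weak convergence, and \<open>y - y'\<close> makes room for the level reached at time
      \<open>t\<close>.\<close>
    define y where "y = (u + v) / 2"
    define y' where "y' = (u + y) / 2"
    have y: "0 < y" "y < v" "u < y'" "y' < y" using assms by (auto simp: y_def y'_def)
    obtain m where m: "m > 0" "limit_tail m < e"
      using N.prob_greater_at_top[OF measurable_Y e(1)] unfolding limit_tail_def by metis
    define T where "T t = exp (\<alpha> * y * h t / 2)" for t
    have T_at_top: "filterlim T at_top at_top"
      unfolding T_def
      by (rule filterlim_compose[OF exp_at_top])
         (use y alpha_pos filterlim_tendsto_pos_mult_at_top[OF tendsto_const _ filterlim_h, of "\<alpha> * y / 2"]
          in \<open>simp add: mult_ac\<close>)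
    obtain r where r: "r > 0" "tail r (exp 1) < e"
      using tail_at_0[of "exp 1" e] e by auto
    \<comment> \<open>As \<open>ln (T t) = \<alpha> * y / 2 * h t\<close>, the bound
      \<open>h (T t) \<ge> K * ln (T t)\<close> yields
      \<open>(m + 2) * h t \<le> y * h (T t)\<close> and
      \<open>y * h t \<le> (y - y') * h (T t)\<close>. Using \<open>m + 2\<close> rather than
      \<open>m + 1\<close> pays for an additive \<open>1\<close>, since eventually
      \<open>h t \<ge> 1\<close>.\<close>
    define K where "K = max ((m + 2) / (y * (\<alpha> * y / 2))) (y / ((y - y') * (\<alpha> * y / 2)))"
    have "eventually (\<lambda>t :: real. limit_tail v \<le> (1 - limit_tail v) * limit_tail u + 7 * e) at_top"
      using eventually_fast_tail_le[of m "m + 1" e, simplified, OF e(1)]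
        eventually_fast_tail_ge[OF y(2) e(1)]
        eventually_compose_filterlim[OF eventually_fast_tail_ge[OF y(2) e(1)] T_at_top]
        eventually_compose_filterlim[OF eventually_fast_tail_le[OF y(3) e(1)] T_at_top]
        eventually_compose_filterlim[OF eventually_h_ge[of K] T_at_top]
        eventually_compose_filterlim[OF eventually_ge_at_top[of "1 / r"] T_at_top]
        eventually_h_ge[of "2 / (\<alpha> * y)"]
        filterlim_at_top[THEN iffD1, OF filterlim_h, rule_format, of 1]
        eventually_gt_at_top[of 0]
    proof eventually_elim
      case (elim t)
      have T: "T t > 0" "ln (T t) = \<alpha> * y / 2 * h t" by (simp_all add: T_def)
      have "exp (ln t) \<le> T t"
        unfolding T_def exp_le_cancel_iff using elim(7) y alpha_pos by (simp add: field_simps)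
      then have "t \<le> T t" using elim(9) by simp
      have c: "\<alpha> * y / 2 > 0" using y alpha_pos by simp
      have "0 \<le> \<alpha> * y / 2 * h t"
        using c elim(8) by (intro mult_nonneg_nonneg) auto
      then have K: "k * (\<alpha> * y / 2 * h t) \<le> h (T t)" if "k \<le> K" for k
        using order_trans[OF mult_right_mono[OF that] elim(5)[unfolded T(2)]] by blast
      have cancel: "a / (b * (\<alpha> * y / 2)) * (\<alpha> * y / 2 * H) = a / b * H" for a b H
        using c by (cases "b = 0") auto
      have "(m + 2) / (y * (\<alpha> * y / 2)) \<le> K" "y / ((y - y') * (\<alpha> * y / 2)) \<le> K"
        by (simp_all add: K_def)
      from this[THEN K] have "(m + 2) / y * h t \<le> h (T t)" "y / (y - y') * h t \<le> h (T t)"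
        unfolding cancel .
      then have hT: "(m + 2) * h t \<le> y * h (T t)" "y * h t \<le> (y - y') * h (T t)"
        using y by (simp_all add: field_simps)
      have "tail (T t) (exp (y * h (T t))) \<le> tail t (exp ((m + 1) * h t)) + tail (1 / T t) (exp 1)
          + (1 - tail t (exp (y * h t))) * tail (T t) (exp (y' * h (T t)))"
      proof (rule two_scale_bound)
        show "(m + 1) * h t + 1 \<le> y * h (T t)"
          using hT(1) elim(8) by (simp add: algebra_simps)
        show "y' * h (T t) + y * h t \<le> y * h (T t)"
          using hT(2) by (simp add: algebra_simps)
      qed (use elim T y \<open>t \<le> T t\<close> in \<open>auto simp: mult_ac\<close>)
      also have "tail (1 / T t) (exp 1) \<le> tail r (exp 1)"
        using elim(6) r(1) T(1) by (intro tail_mono) (auto simp: field_simps)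
      also have "(1 - tail t (exp (y * h t))) * tail (T t) (exp (y' * h (T t)))
          \<le> (1 - (limit_tail v - e)) * (limit_tail u + e)"
        using elim(2,4) e limit_tail_bounds[of v] by (intro mult_mono) (auto simp: tail_def)
      also have "\<dots> = (1 - limit_tail v) * limit_tail u + e * (1 - limit_tail v) + e * limit_tail u + e * e"
        by (simp add: algebra_simps)
      also have "\<dots> \<le> (1 - limit_tail v) * limit_tail u + e * 1 + e * 1 + e * 1"
        using e limit_tail_bounds by (intro add_mono mult_left_mono) auto
      finally show ?case using elim(1,3) m(2) r(2) by simp
    qed
    then show ?thesis using eventually_happens by fastforce
  qed
  note bound = this
  define p where "p = (1 - limit_tail v) * limit_tail u"
  have "0 \<le> p"
    using limit_tail_bounds by (simp add: p_def)
  show ?thesis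
  proof (rule ccontr)
    assume "\<not> ?thesis"
    then have "p < limit_tail v" by (simp add: p_def)
    \<comment> \<open>With this choice of \<open>e\<close> the error \<open>7 * e\<close> is half of
      the supposed excess.\<close>
    moreover from this \<open>0 \<le> p\<close> have "limit_tail v \<le> p + 7 * ((limit_tail v - p) / 14)"
      using bound[of "(limit_tail v - p) / 14"] limit_tail_bounds(2)[of v] by (simp add: p_def)
    ultimately show False by (simp add: field_simps)
  qed
qed

lemma limit_tail_at_0: "(\<lambda>n. limit_tail (1 / real (Suc n))) \<longlonglongrightarrow> limit_tail 0"
proof -
  let ?A = "\<lambda>n. {\<omega> \<in> space N. Y \<omega> > 1 / real (Suc n)}"
  have "(\<lambda>n. measure N (?A n)) \<longlonglongrightarrow> measure N (\<Union>n. ?A n)"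
  proof (rule N.finite_Lim_measure_incseq)
    show "incseq ?A"
      unfolding incseq_def by (auto elim!: le_less_trans[rotated] simp: frac_le)
  qed auto
  also have "(\<Union>n. ?A n) = {\<omega> \<in> space N. Y \<omega> > 0}"
    using reals_Archimedean by (auto simp: inverse_eq_divide intro: less_trans[rotated])
  finally show ?thesis by (simp add: limit_tail_def)
qed

text \<open>Letting \<open>v = 1 / (n + 1)\<close> and \<open>u = 1 / (n + 2)\<close> decrease to
  \<open>0\<close> in the recursion gives \<open>p \<le> (1 - p) * p\<close> for
  \<open>p = limit_tail 0\<close>, so the square of \<open>p\<close> is at most
  \<open>0\<close>.\<close>

lemma limit_tail_0: "limit_tail 0 = 0"
proof -
  have "limit_tail 0 \<le> (1 - limit_tail 0) * limit_tail 0"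
  proof (rule LIMSEQ_le)
    show "(\<lambda>n. limit_tail (1 / real (Suc n))) \<longlonglongrightarrow> limit_tail 0"
      by (rule limit_tail_at_0)
    show "(\<lambda>n. (1 - limit_tail (1 / real (Suc n))) * limit_tail (1 / real (Suc (Suc n))))
        \<longlonglongrightarrow> (1 - limit_tail 0) * limit_tail 0"
      by (intro tendsto_intros limit_tail_at_0 LIMSEQ_Suc[OF limit_tail_at_0])
    show "\<exists>k. \<forall>n\<ge>k. limit_tail (1 / real (Suc n))
        \<le> (1 - limit_tail (1 / real (Suc n))) * limit_tail (1 / real (Suc (Suc n)))"
      by (intro exI allI impI limit_tail_recursion) (auto simp: field_simps)
  qed
  then have "limit_tail 0 * limit_tail 0 \<le> 0" by (simp add: algebra_simps)
  then show ?thesis by (simp add: mult_le_0_iff) (use limit_tail_bounds[of 0] in auto)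
qed

text \<open>Under \<open>P 1\<close> almost surely \<open>X t \<ge> 1\<close>, so
  \<open>ln (X t) / h t\<close> is nonnegative. The level \<open>u / 2\<close> provides the gap
  needed for weak convergence.\<close>

lemma limit_tail_neg:
  assumes "u < 0" shows "limit_tail u = 1"
proof -
  have "1 \<le> limit_tail u + e" if "e > 0" for e
  proof -
    have "u < u / 2" using assms by simp
    from eventually_fast_tail_le[OF this that] eventually_gt_at_top[of 0]
    have "eventually (\<lambda>t :: real. 1 \<le> limit_tail u + e) at_top"
    proof (eventually_elim)
      case (elim t)
      have "tail t (exp (u / 2 * h t)) = measure (P 1) (space (P 1))"
        unfolding tail_def
      proof (rule P1.finite_measure_eq_AE)
        show "AE \<omega> in P 1. \<omega> \<in> {\<omega> \<in> \<Omega>. exp (u / 2 * h t) < X t \<omega>} \<longleftrightarrow> \<omega> \<in> space (P 1)"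
          using AE_ge_1
        proof eventually_elim
          fix \<omega> assume "\<forall>t\<ge>0. X t \<omega> \<ge> 1"
          moreover have "u / 2 * h t < 0"
            using assms h_pos elim by (auto simp: mult_neg_pos)
          ultimately have "exp (u / 2 * h t) < X t \<omega>"
            using elim by (metis exp_less_one_iff less_le_trans less_imp_le)
          then show "\<omega> \<in> {\<omega> \<in> \<Omega>. exp (u / 2 * h t) < X t \<omega>} \<longleftrightarrow> \<omega> \<in> space (P 1)" by simp
        qed
      qed (intro tail_sets sets.top; use elim in simp)+
      then show ?case using elim by (simp only: P1.prob_space)
    qed
    then show ?thesis using eventually_happens by fastforce
  qed
  then show ?thesis using limit_tail_bounds[of u] field_le_epsilon[of 1 "limit_tail u"] by simp
qed

lemma fast_limit_degenerate: "AE \<omega> in N. Y \<omega> = 0"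
proof -
  have "AE \<omega> in N. Y \<omega> \<le> 0"
    using limit_tail_0 by (subst AE_iff_measurable[OF _ refl])
      (auto simp: limit_tail_def N.emeasure_eq_measure not_le)
  moreover have "AE \<omega> in N. \<forall>n. Y \<omega> > - (1 / real (Suc n))"
    unfolding AE_all_countable
  proof
    fix n
    have "measure N {\<omega> \<in> space N. Y \<omega> > - (1 / real (Suc n))} = 1"
      using limit_tail_neg[of "- (1 / real (Suc n))"] by (simp add: limit_tail_def)
    from N.AE_prob_1[OF this] show "AE \<omega> in N. Y \<omega> > - (1 / real (Suc n))"
      by eventually_elim simp
  qed
  ultimately show ?thesis
  proof eventually_elim
    fix \<omega> assume *: "Y \<omega> \<le> 0" "\<forall>n. Y \<omega> > - (1 / real (Suc n))"
    have "Y \<omega> \<ge> 0"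
    proof (rule ccontr)
      assume "\<not> Y \<omega> \<ge> 0"
      then obtain n where "inverse (real (Suc n)) < - Y \<omega>"
        using reals_Archimedean[of "- Y \<omega>"] by auto
      with *(2)[rule_format, of n] show False by (simp add: inverse_eq_divide)
    qed
    with * show "Y \<omega> = 0" by simp
  qed
qed

end

text \<open>By tightness of the limit law, \<open>ln (X t)\<close> is within
  \<open>(m + 1) * h t\<close> of \<open>ln t / \<alpha>\<close> with probability close to
  \<open>1\<close>, and on a slow scale \<open>(m + 1) * h t\<close> is eventually at most
  \<open>\<delta> * ln t\<close>.\<close>

lemma growth_exponent_if_slow_scale:
  assumes slow: "((\<lambda>t. h t / ln t) \<longlongrightarrow> 0) at_top"
  shows "growth_exponent"
  unfolding growth_exponent_def
proof (intro allI impI)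
  fix \<delta> e :: real assume "\<delta> > 0" "e > 0"
  obtain m where m: "m > 0" "limit_tail m < e / 2" "limit_tail (- m) > 1 - e / 2"
    using N.prob_greater_at_top[OF measurable_Y, of "e / 2"] \<open>e > 0\<close> unfolding limit_tail_def by (metis half_gt_zero)
  have "eventually (\<lambda>t. h t / ln t < \<delta> / (m + 1)) at_top"
    by (rule order_tendstoD[OF slow]) (use \<open>\<delta> > 0\<close> m in simp)
  with eventually_gt_at_top[of 1] have small: "eventually (\<lambda>t. t > 1 \<and> (m + 1) * h t \<le> \<delta> * ln t) at_top"
    by eventually_elim (use m in \<open>simp add: field_simps\<close>)
  have "m < m + 1" "- (m + 1) < - m" "e / 2 > 0" using \<open>e > 0\<close> by auto
  note up = eventually_tail_le[OF this(1,3)] and low = eventually_tail_ge[OF this(2,3)]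
  show "eventually (\<lambda>t. tail t (exp ((1 / \<alpha> + \<delta>) * ln t)) \<le> e) at_top \<and>
     eventually (\<lambda>t. tail t (exp ((1 / \<alpha> - \<delta>) * ln t)) \<ge> 1 - e) at_top"
  proof
    show "eventually (\<lambda>t. tail t (exp ((1 / \<alpha> + \<delta>) * ln t)) \<le> e) at_top"
      using small up
    proof eventually_elim
      case (elim t)
      then have "tail t (exp ((1 / \<alpha> + \<delta>) * ln t)) \<le> tail t (exp ((m + 1) * h t + ln t / \<alpha>))"
        by (intro tail_antimono) (auto simp: distrib_right)
      with elim(2) m show ?case by simp
    qed
    show "eventually (\<lambda>t. tail t (exp ((1 / \<alpha> - \<delta>) * ln t)) \<ge> 1 - e) at_top"
      using small low
    proof eventually_elim
      case (elim t)
      then have "tail t (exp (- (m + 1) * h t + ln t / \<alpha>)) \<le> tail t (exp ((1 / \<alpha> - \<delta>) * ln t))"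
        by (intro tail_antimono) (auto simp: left_diff_distrib distrib_right)
      with elim(2) m show ?case by simp
    qed
  qed
qed

end

theorem theorem2:
  fixes \<alpha> :: real
    and P :: "real \<Rightarrow> 'a measure" and X :: "real \<Rightarrow> 'a \<Rightarrow> real"
    and \<xi> :: "real \<Rightarrow> 'a \<Rightarrow> real" and \<phi> h :: "real \<Rightarrow> real"
    and N :: "'b measure" and Y :: "'b \<Rightarrow> real"
  assumes "\<alpha> > 0"
    and "increasing_pssmp \<alpha> P X"
    and "\<xi> = lamperti \<alpha> X"
    and "subordinator (P 1) \<xi>"
    and "\<phi> = laplace_exponent (P 1) \<xi>"
    and "\<not> (\<exists>\<beta>>0. regularly_varying_at_0 \<phi> \<beta>)"
    and "\<And>t. t > 0 \<Longrightarrow> h t > 0"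
    and "((\<lambda>t. h t / ln t) \<longlongrightarrow> 0) at_top \<or> filterlim (\<lambda>t. h t / ln t) at_top at_top"
    and "prob_space N" and "Y \<in> borel_measurable N"
    and "weak_conv_at_top (\<lambda>t. distr (P 1) borel (\<lambda>\<omega>. ln (X t \<omega> / t powr (1 / \<alpha>)) / h t))
           (distr N borel Y)"
  shows "\<exists>c. AE \<omega> in N. Y \<omega> = c"
proof -
  interpret increasing_pssmp \<alpha> P X "space (P 1)" by fact simp
  interpret N: prob_space N by fact
  interpret pssmp_limit \<alpha> P X "space (P 1)" N h Y
    by unfold_locales (use assms in auto)
  \<comment> \<open>A slow scale would make \<open>\<phi>\<close> regularly varying with index
    \<open>1\<close>, contrary to the hypothesis, so only the fast scale remains.\<close>
  have "\<not> growth_exponent"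
    using regularly_varying_if_growth_exponent assms(1,3-6) by (metis zero_less_one)
  with growth_exponent_if_slow_scale assms(8) have "filterlim (\<lambda>t. h t / ln t) at_top at_top"
    by blast
  from fast_limit_degenerate[OF this] show ?thesis by blast
qed

end
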